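(* Let $K\ge1$. For $i=1,\dots,K$ let $\theta^{(i)}>0$ and $\tau^{(i)}\neq0$ be constants. Let $0<\Delta\le\min\{\theta^{(i)}/\tau^{(i)}:\tau^{(i)}>0\}$ if $\tau^{(i)}>0$ for some $i$, and $0<\Delta\le\infty$ otherwise. Let $X^{(1)},\dots,X^{(K)}$ be independent, with $X^{(i)}$ a $(\theta^{(i)},\tau^{(i)})$ GMSI process on $[0,\Delta)$, let $k_1,\dots,k_K$ be real constants, not all zero, let $\rho\in\mathbb R$, and let $$X(t)=\sum_{i=1}^Kk_iX^{(i)}(t),\qquad Z(t)=\rho t+X(t),\qquad 0\le t<\Delta .$$ Let $0\le u<\Delta$, $0<w<\Delta-u$, $\vec x=(x_1,\dots,x_K)\in\mathbb R^K$ and $z\in\mathbb R$, and let $\{Z_{u;\vec x}^{u+w;z}(h):0\le h<w\}$ denote the process $$Z_{u;\vec x}^{u+w;z}(h)=Z(u+h)-Z(u)-\frac{z}{w}h\quad\text{conditional on }X^{(i)}(u)=x_i\ (i=1,\dots,K)\text{ and }Z(u+w)-Z(u)=z .$$ Then $Z_{u;\vec x}^{u+w;z}$ is a $(\theta,\theta/w)$ GMSI process on $[0,w)$, where $\theta=\sum_{i=1}^Kk_i^2\theta^{(i)}$.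
   Context: A $(\theta,\tau)$ GMSI process on $[0,\Delta)$ (where $0<\Delta\le\infty$, $\theta>0$, $\tau\le\theta/\Delta$, with $\theta/\infty=0$) is a real, continuous, zero-mean Gaussian Markov process $X$ with $X(0)=0$, stationary increments, and covariance $E[X(s)X(t)]=s(\theta-\tau t)$ for $0\le s\le t<\Delta$. "Conditional on" means under the regular conditional law given these values (the usual Gaussian conditional law, defined for all $\vec x$, $z$ when $u>0$). When $u=0$ one must have $\vec x=\vec 0$ since $X^{(i)}(0)=0$. *)

theory Defs
  imports "HOL-Probability.Probability"
begin

text \<open>
  Time horizons are extended reals, so that an infinite horizon is allowed; division of extended
  reals already has \<open>a / \<infinity> = 0\<close>.
\<close>

definition time_dom :: "ereal \<Rightarrow> real set" where
  "time_dom \<Delta> = {t. 0 \<le> t \<and> ereal t < \<Delta>}"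

text \<open>
  Degenerate normal laws (variance 0) count as Gaussian; they occur for instance at time 0.
\<close>

definition gaussian_rv :: "'a measure \<Rightarrow> ('a \<Rightarrow> real) \<Rightarrow> bool" where
  "gaussian_rv M Y \<longleftrightarrow>
     Y \<in> borel_measurable M \<and>
     ((\<exists>\<mu> \<sigma>. 0 < \<sigma> \<and> distributed M lborel Y (normal_density \<mu> \<sigma>)) \<or>
      (\<exists>\<mu>. AE \<omega> in M. Y \<omega> = \<mu>))"

definition gaussian_process :: "'a measure \<Rightarrow> real set \<Rightarrow> (real \<Rightarrow> 'a \<Rightarrow> real) \<Rightarrow> bool" where
  "gaussian_process M T X \<longleftrightarrow>
     (\<forall>I a. finite I \<and> I \<subseteq> T \<longrightarrow> gaussian_rv M (\<lambda>\<omega>. \<Sum>t\<in>I. a t * X t \<omega>))"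

definition past_algebra ::
    "'a measure \<Rightarrow> real set \<Rightarrow> (real \<Rightarrow> 'a \<Rightarrow> real) \<Rightarrow> real \<Rightarrow> 'a measure" where
  "past_algebra M T X s =
     vimage_algebra (space M) (\<lambda>\<omega>. \<lambda>r\<in>{r \<in> T. r \<le> s}. X r \<omega>)
       (\<Pi>\<^sub>M r\<in>{r \<in> T. r \<le> s}. borel)"

definition markov_process :: "'a measure \<Rightarrow> real set \<Rightarrow> (real \<Rightarrow> 'a \<Rightarrow> real) \<Rightarrow> bool" where
  "markov_process M T X \<longleftrightarrow>
     (\<forall>s\<in>T. \<forall>t\<in>T. s \<le> t \<longrightarrow> (\<forall>B\<in>sets borel. AE \<omega> in M.
        real_cond_exp M (past_algebra M T X s) (\<lambda>\<omega>'. indicator B (X t \<omega>')) \<omega> =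
        real_cond_exp M (vimage_algebra (space M) (X s) borel) (\<lambda>\<omega>'. indicator B (X t \<omega>')) \<omega>))"

text \<open>
  Stationarity of the increments is meant for the process of increments, that is, for all its
  finite-dimensional laws.
\<close>

definition stationary_increments ::
    "'a measure \<Rightarrow> ereal \<Rightarrow> (real \<Rightarrow> 'a \<Rightarrow> real) \<Rightarrow> bool" where
  "stationary_increments M \<Delta> X \<longleftrightarrow>
     (\<forall>s\<in>time_dom \<Delta>. \<forall>I. finite I \<and> (\<forall>h\<in>I. 0 \<le> h \<and> s + h \<in> time_dom \<Delta>) \<longrightarrow>
        distr M (\<Pi>\<^sub>M h\<in>I. borel) (\<lambda>\<omega>. \<lambda>h\<in>I. X (s + h) \<omega> - X s \<omega>) =
        distr M (\<Pi>\<^sub>M h\<in>I. borel) (\<lambda>\<omega>. \<lambda>h\<in>I. X h \<omega> - X 0 \<omega>))"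

definition gmsi_process ::
    "'a measure \<Rightarrow> ereal \<Rightarrow> real \<Rightarrow> real \<Rightarrow> (real \<Rightarrow> 'a \<Rightarrow> real) \<Rightarrow> bool" where
  "gmsi_process M \<Delta> \<theta> \<tau> X \<longleftrightarrow>
     0 < \<Delta> \<and> 0 < \<theta> \<and> ereal \<tau> \<le> ereal \<theta> / \<Delta> \<and>
     prob_space M \<and>
     (\<forall>\<omega>\<in>space M. continuous_on (time_dom \<Delta>) (\<lambda>t. X t \<omega>)) \<and>
     gaussian_process M (time_dom \<Delta>) X \<and>
     (\<forall>t\<in>time_dom \<Delta>. prob_space.expectation M (X t) = 0) \<and>
     markov_process M (time_dom \<Delta>) X \<and>
     (AE \<omega> in M. X 0 \<omega> = 0) \<and>
     stationary_increments M \<Delta> X \<and>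
     (\<forall>s\<in>time_dom \<Delta>. \<forall>t\<in>time_dom \<Delta>. s \<le> t \<longrightarrow>
        prob_space.expectation M (\<lambda>\<omega>. X s \<omega> * X t \<omega>) = s * (\<theta> - \<tau> * t))"

definition path_space :: "real set \<Rightarrow> (real \<Rightarrow> real) measure" where
  "path_space T = restrict_space (\<Pi>\<^sub>M t\<in>T. borel) {f. continuous_on T f}"

definition regular_conditional_law ::
    "'a measure \<Rightarrow> 'c measure \<Rightarrow> 'b measure \<Rightarrow> ('a \<Rightarrow> 'c) \<Rightarrow> ('a \<Rightarrow> 'b) \<Rightarrow> ('c \<Rightarrow> 'b measure) \<Rightarrow> bool"
  where
  "regular_conditional_law M S N C Y \<kappa> \<longleftrightarrow>
     \<kappa> \<in> S \<rightarrow>\<^sub>M prob_algebra N \<and>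
     (\<forall>A\<in>sets S. \<forall>B\<in>sets N.
        emeasure M {\<omega> \<in> space M. C \<omega> \<in> A \<and> Y \<omega> \<in> B} =
        (\<integral>\<^sup>+ \<omega>. indicator A (C \<omega>) * emeasure (\<kappa> (C \<omega>)) B \<partial>M))"

text \<open>
  A regular conditional law is determined only almost everywhere in the conditioning value.
  The usual Gaussian conditional law, which is defined for every conditioning value \<open>c\<close>, is the
  version whose finite-dimensional laws (tested on linear combinations, by Cramer and Wold) depend
  weakly continuously on \<open>c\<close>; this determines \<open>\<kappa> c\<close> for every \<open>c\<close> in the support of the law
  of \<open>C\<close>.
\<close>

definition conditional_path_law ::
    "'a measure \<Rightarrow> real set \<Rightarrow> ('a \<Rightarrow> 'c::metric_space) \<Rightarrow> (real \<Rightarrow> 'a \<Rightarrow> real) \<Rightarrow>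
     ('c \<Rightarrow> (real \<Rightarrow> real) measure) \<Rightarrow> bool" where
  "conditional_path_law M T C Y \<kappa> \<longleftrightarrow>
     regular_conditional_law M borel (path_space T) C (\<lambda>\<omega>. \<lambda>t\<in>T. Y t \<omega>) \<kappa> \<and>
     (\<forall>c c' J a. c' \<longlonglongrightarrow> c \<and> finite J \<and> J \<subseteq> T \<longrightarrow>
        weak_conv_m (\<lambda>n. distr (\<kappa> (c' n)) borel (\<lambda>f. \<Sum>t\<in>J. a t * f t))
                    (distr (\<kappa> c) borel (\<lambda>f. \<Sum>t\<in>J. a t * f t)))"

end

theory Submission
  imports Defs
begin

text \<open>
  Put \<open>D h = Z (u + h) - Z u\<close> and \<open>B h = D h - (h / w) D w\<close>. The covariance of \<open>D h\<close> with each
  \<open>X i u\<close> and with \<open>D w\<close> is linear in \<open>h\<close>, so subtracting the chord kills both: the bridge \<open>B\<close> is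
  uncorrelated with, hence independent of, the conditioning vector \<open>C\<close>. Thus the law of
  \<open>B h + (h / w) z\<close> is a conditional law given \<open>C = (x, z)\<close>, and \<open>B\<close> has the covariance of the
  claimed GMSI process. Two conditional laws agree almost everywhere; by weak continuity they agree on
  the support of the law of \<open>C\<close>, which contains \<open>(x, z)\<close> because the part of \<open>D w\<close> not explained
  by the \<open>X i u\<close> has positive variance.
\<close>

subsection \<open>Laws determined by trigonometric integrals\<close>

text \<open>The statement quantifies over every version of the conditional law, and of such a
  version only the laws of finite linear combinations are under control at the given
  \<open>(x, z)\<close>. Each property of a GMSI process is therefore reduced to trigonometric
  integrals of such combinations: they yield Gaussianity and all covariances, and the covariances in
  turn yield the Markov property and stationarity. Path continuity alone comes from the path space.
  Working with \<open>cis\<close> also treats variance 0 uniformly; it occurs at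
  \<open>h = 0\<close>, and for the conditioning values at \<open>u = 0\<close>. The new parameters
  can be read off the covariance. With \<Theta> and \<T> the sums of the \<open>\<theta> i\<close>
  and of the \<open>\<tau> i\<close>, weighted by the squares of the \<open>k i\<close>, the
  increments have covariance h (\<Theta> - \<T> l) for h \<le> l. The chord contributes - (h / w) l
  (\<Theta> - \<T> w), so \<T> cancels and h (\<Theta> - (\<Theta> / w) l) remains.\<close>

lemma borel_measurable_cis [measurable (raw)]:
  "f \<in> borel_measurable M \<Longrightarrow> (\<lambda>x. cis (f x)) \<in> borel_measurable M"
  by (rule borel_measurable_continuous_on[of cis]) (auto intro!: continuous_intros)

lemma (in prob_space) integrable_bounded_mult_cis:
  fixes f :: "'a \<Rightarrow> real" and g :: "'a \<Rightarrow> real"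
  assumes [measurable]: "f \<in> borel_measurable M" "g \<in> borel_measurable M"
    and "\<And>\<omega>. \<bar>g \<omega>\<bar> \<le> B"
  shows "integrable M (\<lambda>\<omega>. complex_of_real (g \<omega>) * cis (f \<omega>))"
  by (rule integrable_const_bound[of _ B]) (use assms(3) in \<open>auto simp: norm_mult\<close>)

lemma (in prob_space) integrable_cis:
  "f \<in> borel_measurable M \<Longrightarrow> integrable M (\<lambda>\<omega>. cis (f \<omega>))"
  by (rule integrable_const_bound[of _ 1]) auto

lemma char_distr_eq_cis:
  "X \<in> borel_measurable M \<Longrightarrow> char (distr M borel X) s = (LINT \<omega>|M. cis (s * X \<omega>))"
  by (simp add: char_def integral_distr cis_conv_exp)

lemma (in prob_space) real_distribution_distr:
  "X \<in> borel_measurable M \<Longrightarrow> real_distribution (distr M borel X)"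
  by (auto simp: real_distribution_def real_distribution_axioms_def prob_space_distr)

lemma distr_eq_of_cis_eq:
  fixes X :: "'a \<Rightarrow> real" and X' :: "'b \<Rightarrow> real"
  assumes "prob_space M" "prob_space N"
    and "X \<in> borel_measurable M" "X' \<in> borel_measurable N"
    and "\<And>s. (LINT \<omega>|M. cis (s * X \<omega>)) = (LINT \<omega>|N. cis (s * X' \<omega>))"
  shows "distr M borel X = distr N borel X'"
  by (rule Levy_uniqueness) (auto simp: fun_eq_iff char_distr_eq_cis assms
      intro: prob_space.real_distribution_distr)

text \<open>The frequency \<open>s = 0\<close> shows that both weights have the same mass
  \<open>m\<close>. If \<open>m > 0\<close>, then \<open>h / m\<close> and \<open>h' / m\<close> are
  probability densities, and Levy's theorem under the reweighted measures identifies the laws of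
  \<open>X\<close> and \<open>X'\<close>. If \<open>m = 0\<close>, both weights vanish almost
  everywhere.\<close>

lemma integral_indicator_eq_of_cis_eq_nonneg:
  fixes X :: "'a \<Rightarrow> real" and X' :: "'b \<Rightarrow> real"
  assumes "prob_space M" "prob_space N"
    and [measurable]: "X \<in> borel_measurable M" "X' \<in> borel_measurable N"
    and [measurable]: "h \<in> borel_measurable M" "h' \<in> borel_measurable N"
    and h: "\<And>\<omega>. 0 \<le> h \<omega>" "\<And>\<omega>. h \<omega> \<le> B" and h': "\<And>\<omega>. 0 \<le> h' \<omega>" "\<And>\<omega>. h' \<omega> \<le> B"
    and eq: "\<And>s. (LINT \<omega>|M. complex_of_real (h \<omega>) * cis (s * X \<omega>)) =
                  (LINT \<omega>|N. complex_of_real (h' \<omega>) * cis (s * X' \<omega>))"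
    and [measurable]: "A \<in> sets borel"
  shows "(LINT \<omega>|M. h \<omega> * indicator A (X \<omega>)) = (LINT \<omega>|N. h' \<omega> * indicator A (X' \<omega>))"
proof -
  interpret M: prob_space M by fact
  interpret N: prob_space N by fact
  have int: "integrable M h" "integrable N h'"
    using h h' by (auto intro!: M.integrable_const_bound[of _ B] N.integrable_const_bound[of _ B])
  define m where "m = (LINT \<omega>|M. h \<omega>)"
  have m: "m = (LINT \<omega>|N. h' \<omega>)"
  proof -
    have "complex_of_real m = complex_of_real (LINT \<omega>|N. h' \<omega>)"
      using eq[of 0] by (simp add: m_def)
    then show ?thesis by simp
  qed
  have "0 \<le> m" unfolding m_def using h by (intro integral_nonneg_AE) auto
  show ?thesis
  proof (cases "m = 0")
    case True
    have "AE \<omega> in M. h \<omega> = 0"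
      using True int h by (subst (asm) m_def) (simp add: integral_nonneg_eq_0_iff_AE)
    moreover have "AE \<omega> in N. h' \<omega> = 0"
      using True int h' by (subst (asm) m) (simp add: integral_nonneg_eq_0_iff_AE)
    ultimately have "(LINT \<omega>|M. h \<omega> * indicator A (X \<omega>)) = 0"
        "(LINT \<omega>|N. h' \<omega> * indicator A (X' \<omega>)) = 0"
      by (auto intro!: integral_eq_zero_AE)
    then show ?thesis by simp
  next
    case False
    with \<open>0 \<le> m\<close> have "m > 0" by simp
    let ?M = "density M (\<lambda>\<omega>. ennreal (h \<omega> / m))" and ?N = "density N (\<lambda>\<omega>. ennreal (h' \<omega> / m))"
    have "prob_space ?M"
    proof
      have "emeasure ?M (space ?M) = (\<integral>\<^sup>+ \<omega>. ennreal (h \<omega> / m) \<partial>M)"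
        by (simp add: emeasure_density cong: nn_integral_cong)
      also have "\<dots> = ennreal (LINT \<omega>|M. h \<omega> / m)"
        using h \<open>m > 0\<close> int by (intro nn_integral_eq_integral) auto
      finally show "emeasure ?M (space ?M) = 1"
        using \<open>m > 0\<close> by (simp add: m_def)
    qed
    moreover have "prob_space ?N"
    proof
      have "emeasure ?N (space ?N) = (\<integral>\<^sup>+ \<omega>. ennreal (h' \<omega> / m) \<partial>N)"
        by (simp add: emeasure_density cong: nn_integral_cong)
      also have "\<dots> = ennreal (LINT \<omega>|N. h' \<omega> / m)"
        using h' \<open>m > 0\<close> int by (intro nn_integral_eq_integral) auto
      finally show "emeasure ?N (space ?N) = 1"
        using \<open>m > 0\<close> by (simp add: m)
    qed
    moreover have "(LINT \<omega>|?M. cis (s * X \<omega>)) = (LINT \<omega>|?N. cis (s * X' \<omega>))" for s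
    proof -
      have "(LINT \<omega>|?M. cis (s * X \<omega>)) = (LINT \<omega>|M. complex_of_real (h \<omega>) * cis (s * X \<omega>)) / m"
        using h \<open>m > 0\<close> by (simp add: integral_density scaleR_conv_of_real)
      moreover have "(LINT \<omega>|?N. cis (s * X' \<omega>)) = (LINT \<omega>|N. complex_of_real (h' \<omega>) * cis (s * X' \<omega>)) / m"
        using h' \<open>m > 0\<close> by (simp add: integral_density scaleR_conv_of_real)
      ultimately show ?thesis using eq by simp
    qed
    ultimately have "distr ?M borel X = distr ?N borel X'"
      by (intro distr_eq_of_cis_eq) auto
    then have "(LINT x|distr ?M borel X. indicator A x :: real) = (LINT x|distr ?N borel X'. indicator A x)"
      by simp
    moreover have "(LINT x|distr ?M borel X. indicator A x :: real) = (LINT \<omega>|M. h \<omega> * indicator A (X \<omega>) / m)"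
      using h \<open>m > 0\<close> by (subst integral_distr, simp, simp, subst integral_density) auto
    moreover have "(LINT x|distr ?N borel X'. indicator A x :: real) = (LINT \<omega>|N. h' \<omega> * indicator A (X' \<omega>) / m)"
      using h' \<open>m > 0\<close> by (subst integral_distr, simp, simp, subst integral_density) auto
    ultimately have "(LINT \<omega>|M. h \<omega> * indicator A (X \<omega>) / m) = (LINT \<omega>|N. h' \<omega> * indicator A (X' \<omega>) / m)"
      by simp
    then show ?thesis using \<open>m > 0\<close> by simp
  qed
qed

text \<open>
  Adding 1 makes the weight nonnegative, so that Levy's uniqueness theorem applies to densities.
\<close>

lemma integral_indicator_eq_of_cis_eq:
  fixes X :: "'a \<Rightarrow> real" and X' :: "'b \<Rightarrow> real"
  assumes "prob_space M" "prob_space N"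
    and [measurable]: "X \<in> borel_measurable M" "X' \<in> borel_measurable N"
    and [measurable]: "g \<in> borel_measurable M" "g' \<in> borel_measurable N"
    and g: "\<And>\<omega>. \<bar>g \<omega>\<bar> \<le> 1" and g': "\<And>\<omega>. \<bar>g' \<omega>\<bar> \<le> 1"
    and eq1: "\<And>s. (LINT \<omega>|M. cis (s * X \<omega>)) = (LINT \<omega>|N. cis (s * X' \<omega>))"
    and eqg: "\<And>s. (LINT \<omega>|M. complex_of_real (g \<omega>) * cis (s * X \<omega>)) =
                  (LINT \<omega>|N. complex_of_real (g' \<omega>) * cis (s * X' \<omega>))"
    and [measurable]: "A \<in> sets borel"
  shows "(LINT \<omega>|M. g \<omega> * indicator A (X \<omega>)) = (LINT \<omega>|N. g' \<omega> * indicator A (X' \<omega>))"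
proof -
  interpret M: prob_space M by fact
  interpret N: prob_space N by fact
  have "0 \<le> 1 + g \<omega>" "1 + g \<omega> \<le> 2" for \<omega> using g[of \<omega>] by auto
  moreover have "0 \<le> 1 + g' \<omega>" "1 + g' \<omega> \<le> 2" for \<omega> using g'[of \<omega>] by auto
  moreover have "(LINT \<omega>|M. complex_of_real (1 + g \<omega>) * cis (s * X \<omega>)) =
                  (LINT \<omega>|N. complex_of_real (1 + g' \<omega>) * cis (s * X' \<omega>))" for s
    using eq1[of s] eqg[of s] g g'
    by (simp add: ring_distribs M.integrable_cis N.integrable_cis
        M.integrable_bounded_mult_cis[of _ _ 1] N.integrable_bounded_mult_cis[of _ _ 1])
  ultimately have 1: "(LINT \<omega>|M. (1 + g \<omega>) * indicator A (X \<omega>)) = (LINT \<omega>|N. (1 + g' \<omega>) * indicator A (X' \<omega>))"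
    by (intro integral_indicator_eq_of_cis_eq_nonneg[where B = 2, OF assms(1,2)]) auto
  have 2: "(LINT \<omega>|M. 1 * indicator A (X \<omega>)) = (LINT \<omega>|N. 1 * indicator A (X' \<omega>) :: real)"
    using eq1 by (intro integral_indicator_eq_of_cis_eq_nonneg[where B = 1, OF assms(1,2)]) auto
  have "integrable M (\<lambda>\<omega>. g \<omega> * indicator A (X \<omega>))" "integrable N (\<lambda>\<omega>. g' \<omega> * indicator A (X' \<omega>))"
    using g g' by (auto intro!: M.integrable_const_bound[of _ 1] N.integrable_const_bound[of _ 1]
        split: split_indicator)
  moreover have "integrable M (\<lambda>\<omega>. indicator A (X \<omega>) :: real)" "integrable N (\<lambda>\<omega>. indicator A (X' \<omega>) :: real)"
    by (auto intro!: M.integrable_const_bound[of _ 1] N.integrable_const_bound[of _ 1]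
        split: split_indicator)
  ultimately show ?thesis
    using 1 2 by (simp add: ring_distribs del: integral_indicator)
qed

text \<open>
  A multivariate uniqueness theorem from the one-dimensional one: the induction on \<open>J\<close> trades the
  trigonometric factors for indicators one coordinate at a time.
\<close>

lemma integral_prod_indicator_cis_eq:
  fixes X :: "'i \<Rightarrow> 'a \<Rightarrow> real" and X' :: "'i \<Rightarrow> 'b \<Rightarrow> real"
  assumes "prob_space M" "prob_space N" and I: "finite I"
    and X: "\<And>i. i \<in> I \<Longrightarrow> X i \<in> borel_measurable M"
    and X': "\<And>i. i \<in> I \<Longrightarrow> X' i \<in> borel_measurable N"
    and eq: "\<And>a. (LINT \<omega>|M. cis (\<Sum>i\<in>I. a i * X i \<omega>)) = (LINT \<omega>|N. cis (\<Sum>i\<in>I. a i * X' i \<omega>))"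
    and "J \<subseteq> I" and "\<And>j. j \<in> J \<Longrightarrow> A j \<in> sets borel"
  shows "(LINT \<omega>|M. complex_of_real (\<Prod>j\<in>J. indicator (A j) (X j \<omega>)) * cis (\<Sum>i\<in>I-J. a i * X i \<omega>)) =
         (LINT \<omega>|N. complex_of_real (\<Prod>j\<in>J. indicator (A j) (X' j \<omega>)) * cis (\<Sum>i\<in>I-J. a i * X' i \<omega>))"
proof -
  interpret M: prob_space M by fact
  interpret N: prob_space N by fact
  have "finite J" using I \<open>J \<subseteq> I\<close> by (rule finite_subset[rotated])
  then show ?thesis using \<open>J \<subseteq> I\<close> assms(8)
  proof (induction J arbitrary: a)
    case empty
    then show ?case using eq by simp
  next
    case (insert j J)
    note X[measurable] X'[measurable]
    let ?K = "I - insert j J"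
    have j: "j \<in> I" "j \<notin> J" and J: "J \<subseteq> I" and [measurable]: "A j \<in> sets borel" "\<And>i. i \<in> J \<Longrightarrow> A i \<in> sets borel"
      using insert by auto
    note [measurable] = X[OF j(1)] X'[OF j(1)]
    define S where "S = (\<lambda>\<omega>. \<Sum>i\<in>?K. a i * X i \<omega>)"
    define S' where "S' = (\<lambda>\<omega>. \<Sum>i\<in>?K. a i * X' i \<omega>)"
    define p where "p = (\<lambda>\<omega>. \<Prod>j\<in>J. indicator (A j) (X j \<omega>) :: real)"
    define p' where "p' = (\<lambda>\<omega>. \<Prod>j\<in>J. indicator (A j) (X' j \<omega>) :: real)"
    have [measurable]: "S \<in> borel_measurable M" "S' \<in> borel_measurable N"
      unfolding S_def S'_def by measurable
    have [measurable]: "p \<in> borel_measurable M"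
      unfolding p_def using X J by (intro borel_measurable_prod borel_measurable_indicator') auto
    have [measurable]: "p' \<in> borel_measurable N"
      unfolding p'_def using X' J by (intro borel_measurable_prod borel_measurable_indicator') auto
    have p: "0 \<le> p \<omega>" "p \<omega> \<le> 1" for \<omega>
      unfolding p_def by (auto intro!: prod_nonneg prod_le_1)
    have p': "0 \<le> p' \<omega>" "p' \<omega> \<le> 1" for \<omega>
      unfolding p'_def by (auto intro!: prod_nonneg prod_le_1)
    \<comment> \<open>The coefficient vector of the induction hypothesis is chosen as
      \<open>b * a i\<close> away from \<open>j\<close> and \<open>s\<close> at \<open>j\<close>.
      The values \<open>b = 1\<close> and \<open>b = - 1\<close> are the ones needed: together they
      produce the cosine and the sine of \<open>S\<close>.\<close>
    have IH: "(LINT \<omega>|M. complex_of_real (p \<omega>) * cis (b * S \<omega> + s * X j \<omega>)) =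
        (LINT \<omega>|N. complex_of_real (p' \<omega>) * cis (b * S' \<omega> + s * X' j \<omega>))" for b s
    proof -
      have sum: "(\<Sum>i\<in>I-J. (if i = j then s else b * a i) * f i) = b * (\<Sum>i\<in>?K. a i * f i) + s * f j" for f
      proof -
        have "(\<Sum>i\<in>I-J. (if i = j then s else b * a i) * f i) =
            (\<Sum>i\<in>insert j ?K. (if i = j then s else b * a i) * f i)"
          by (rule sum.cong) (use j in auto)
        also have "\<dots> = s * f j + (\<Sum>i\<in>?K. (if i = j then s else b * a i) * f i)"
          using I by (subst sum.insert) auto
        also have "(\<Sum>i\<in>?K. (if i = j then s else b * a i) * f i) = b * (\<Sum>i\<in>?K. a i * f i)"
          unfolding sum_distrib_left by (intro sum.cong) auto
        finally show ?thesis by simp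
      qed
      show ?thesis
        using insert.IH[OF J, of "\<lambda>i. if i = j then s else b * a i"] insert.prems(2)
        unfolding S_def S'_def p_def p'_def sum by simp
    qed
    have e1: "(LINT \<omega>|M. cis (s * X j \<omega>)) = (LINT \<omega>|N. cis (s * X' j \<omega>))" for s
    proof -
      have "(\<Sum>i\<in>I. (if i = j then s else 0) * f i) = (\<Sum>i\<in>I. if i = j then s * f j else 0)" for f
        by (intro sum.cong) auto
      then have "(\<Sum>i\<in>I. (if i = j then s else 0) * f i) = s * f j" for f
        using I j by simp
      then show ?thesis using eq[of "\<lambda>i. if i = j then s else 0"] by simp
    qed
    \<comment> \<open>The one-dimensional result takes real weights, so
      \<open>cis (S \<omega>)\<close> is split into cosine and sine, and each of these is written as
      a combination of \<open>cis (S \<omega>)\<close> and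
      \<open>cis (- S \<omega>)\<close>.\<close>
    have cos_eq: "(LINT \<omega>|M. complex_of_real (p \<omega> * cos (S \<omega>)) * cis (s * X j \<omega>)) =
        (LINT \<omega>|N. complex_of_real (p' \<omega> * cos (S' \<omega>)) * cis (s * X' j \<omega>))" for s
    proof -
      have *: "complex_of_real (q * cos t) * cis r = (1/2) * (complex_of_real q * cis (1 * t + r)) + (1/2) * (complex_of_real q * cis ((-1) * t + r))" for q t r
        by (simp add: complex_eq_iff cos_add sin_add cos_diff sin_diff) (simp add: field_simps)
      have "(LINT \<omega>|M. complex_of_real (p \<omega> * cos (S \<omega>)) * cis (s * X j \<omega>)) =
          (1/2) * (LINT \<omega>|M. complex_of_real (p \<omega>) * cis (1 * S \<omega> + s * X j \<omega>)) +
          (1/2) * (LINT \<omega>|M. complex_of_real (p \<omega>) * cis ((-1) * S \<omega> + s * X j \<omega>))"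
        unfolding * integral_mult_right_zero[symmetric] using p
        by (intro Bochner_Integration.integral_add integrable_mult_right M.integrable_bounded_mult_cis[of _ _ 1]) auto
      moreover have "(LINT \<omega>|N. complex_of_real (p' \<omega> * cos (S' \<omega>)) * cis (s * X' j \<omega>)) =
          (1/2) * (LINT \<omega>|N. complex_of_real (p' \<omega>) * cis (1 * S' \<omega> + s * X' j \<omega>)) +
          (1/2) * (LINT \<omega>|N. complex_of_real (p' \<omega>) * cis ((-1) * S' \<omega> + s * X' j \<omega>))"
        unfolding * integral_mult_right_zero[symmetric] using p'
        by (intro Bochner_Integration.integral_add integrable_mult_right N.integrable_bounded_mult_cis[of _ _ 1]) auto
      ultimately show ?thesis by (simp only: IH)
    qed
    have sin_eq: "(LINT \<omega>|M. complex_of_real (p \<omega> * sin (S \<omega>)) * cis (s * X j \<omega>)) =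
        (LINT \<omega>|N. complex_of_real (p' \<omega> * sin (S' \<omega>)) * cis (s * X' j \<omega>))" for s
    proof -
      have *: "complex_of_real (q * sin t) * cis r = (-\<i>/2) * (complex_of_real q * cis (1 * t + r)) + (\<i>/2) * (complex_of_real q * cis ((-1) * t + r))" for q t r
        by (simp add: complex_eq_iff cos_add sin_add cos_diff sin_diff) (simp add: field_simps)
      have "(LINT \<omega>|M. complex_of_real (p \<omega> * sin (S \<omega>)) * cis (s * X j \<omega>)) =
          (-\<i>/2) * (LINT \<omega>|M. complex_of_real (p \<omega>) * cis (1 * S \<omega> + s * X j \<omega>)) +
          (\<i>/2) * (LINT \<omega>|M. complex_of_real (p \<omega>) * cis ((-1) * S \<omega> + s * X j \<omega>))"
        unfolding * integral_mult_right_zero[symmetric] using p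
        by (intro Bochner_Integration.integral_add integrable_mult_right M.integrable_bounded_mult_cis[of _ _ 1]) auto
      moreover have "(LINT \<omega>|N. complex_of_real (p' \<omega> * sin (S' \<omega>)) * cis (s * X' j \<omega>)) =
          (-\<i>/2) * (LINT \<omega>|N. complex_of_real (p' \<omega>) * cis (1 * S' \<omega> + s * X' j \<omega>)) +
          (\<i>/2) * (LINT \<omega>|N. complex_of_real (p' \<omega>) * cis ((-1) * S' \<omega> + s * X' j \<omega>))"
        unfolding * integral_mult_right_zero[symmetric] using p'
        by (intro Bochner_Integration.integral_add integrable_mult_right N.integrable_bounded_mult_cis[of _ _ 1]) auto
      ultimately show ?thesis by (simp only: IH)
    qed
    have b: "\<bar>p \<omega> * cos t\<bar> \<le> 1" "\<bar>p \<omega> * sin t\<bar> \<le> 1" "\<bar>p' \<omega>' * cos t\<bar> \<le> 1" "\<bar>p' \<omega>' * sin t\<bar> \<le> 1" for \<omega> \<omega>' t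
      using p[of \<omega>] p'[of \<omega>'] by (auto simp: abs_mult intro!: mult_le_one)
    have c: "(LINT \<omega>|M. (p \<omega> * cos (S \<omega>)) * indicator (A j) (X j \<omega>)) =
        (LINT \<omega>|N. (p' \<omega> * cos (S' \<omega>)) * indicator (A j) (X' j \<omega>))"
      by (rule integral_indicator_eq_of_cis_eq[OF assms(1,2) _ _ _ _ b(1,3) e1 cos_eq]) measurable
    have s: "(LINT \<omega>|M. (p \<omega> * sin (S \<omega>)) * indicator (A j) (X j \<omega>)) =
        (LINT \<omega>|N. (p' \<omega> * sin (S' \<omega>)) * indicator (A j) (X' j \<omega>))"
      by (rule integral_indicator_eq_of_cis_eq[OF assms(1,2) _ _ _ _ b(2,4) e1 sin_eq]) measurable
    have split: "complex_of_real (i * q) * cis t = complex_of_real (q * cos t * i) + \<i> * complex_of_real (q * sin t * i)" for i q t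
      by (auto simp: complex_eq_iff)
    have "(LINT \<omega>|M. complex_of_real (\<Prod>j\<in>insert j J. indicator (A j) (X j \<omega>)) * cis (S \<omega>)) =
        complex_of_real (LINT \<omega>|M. (p \<omega> * cos (S \<omega>)) * indicator (A j) (X j \<omega>)) +
        \<i> * complex_of_real (LINT \<omega>|M. (p \<omega> * sin (S \<omega>)) * indicator (A j) (X j \<omega>))"
      (is "?l = _")
    proof -
      have "?l = (LINT \<omega>|M. complex_of_real (p \<omega> * cos (S \<omega>) * indicator (A j) (X j \<omega>)) +
            \<i> * complex_of_real (p \<omega> * sin (S \<omega>) * indicator (A j) (X j \<omega>)))"
        using j by (simp only: prod.insert[OF \<open>finite J\<close> j(2)] split p_def)
      also have "\<dots> = (LINT \<omega>|M. complex_of_real (p \<omega> * cos (S \<omega>) * indicator (A j) (X j \<omega>))) +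
            \<i> * (LINT \<omega>|M. complex_of_real (p \<omega> * sin (S \<omega>) * indicator (A j) (X j \<omega>)))"
        using b by (subst Bochner_Integration.integral_add)
          (auto intro!: integrable_of_real M.integrable_const_bound[of _ 1]
            integrable_mult_right simp del: of_real_mult split: split_indicator)
      finally show ?thesis by (simp only: integral_complex_of_real)
    qed
    moreover have "(LINT \<omega>|N. complex_of_real (\<Prod>j\<in>insert j J. indicator (A j) (X' j \<omega>)) * cis (S' \<omega>)) =
        complex_of_real (LINT \<omega>|N. (p' \<omega> * cos (S' \<omega>)) * indicator (A j) (X' j \<omega>)) +
        \<i> * complex_of_real (LINT \<omega>|N. (p' \<omega> * sin (S' \<omega>)) * indicator (A j) (X' j \<omega>))"
      (is "?l = _")
    proof -
      have "?l = (LINT \<omega>|N. complex_of_real (p' \<omega> * cos (S' \<omega>) * indicator (A j) (X' j \<omega>)) +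
            \<i> * complex_of_real (p' \<omega> * sin (S' \<omega>) * indicator (A j) (X' j \<omega>)))"
        using j by (simp only: prod.insert[OF \<open>finite J\<close> j(2)] split p'_def)
      also have "\<dots> = (LINT \<omega>|N. complex_of_real (p' \<omega> * cos (S' \<omega>) * indicator (A j) (X' j \<omega>))) +
            \<i> * (LINT \<omega>|N. complex_of_real (p' \<omega> * sin (S' \<omega>) * indicator (A j) (X' j \<omega>)))"
        using b by (subst Bochner_Integration.integral_add)
          (auto intro!: integrable_of_real N.integrable_const_bound[of _ 1]
            integrable_mult_right simp del: of_real_mult split: split_indicator)
      finally show ?thesis by (simp only: integral_complex_of_real)
    qed
    ultimately show ?case using c s by (simp add: S_def S'_def)
  qed
qed

text \<open>A Cramer-Wold theorem for an arbitrary index set: finite measures on a product are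
  determined by cylinders over finite \<open>J\<close>, and on a cylinder only the coordinates in
  \<open>J\<close> matter.\<close>

lemma distr_PiM_eq_of_cis_eq:
  fixes X :: "'i \<Rightarrow> 'a \<Rightarrow> real" and X' :: "'i \<Rightarrow> 'b \<Rightarrow> real"
  assumes M: "prob_space M" and N: "prob_space N"
    and X: "\<And>i. i \<in> I \<Longrightarrow> X i \<in> borel_measurable M"
    and X': "\<And>i. i \<in> I \<Longrightarrow> X' i \<in> borel_measurable N"
    and eq: "\<And>J a. finite J \<Longrightarrow> J \<subseteq> I \<Longrightarrow>
      (LINT \<omega>|M. cis (\<Sum>i\<in>J. a i * X i \<omega>)) = (LINT \<omega>|N. cis (\<Sum>i\<in>J. a i * X' i \<omega>))"
  shows "distr M (\<Pi>\<^sub>M i\<in>I. borel) (\<lambda>\<omega>. \<lambda>i\<in>I. X i \<omega>) = distr N (\<Pi>\<^sub>M i\<in>I. borel) (\<lambda>\<omega>. \<lambda>i\<in>I. X' i \<omega>)"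
proof (rule measure_eqI_PiM_infinite[where I = I and M = "\<lambda>_. borel"])
  interpret M: prob_space M by fact
  interpret N: prob_space N by fact
  have mX: "(\<lambda>\<omega>. \<lambda>i\<in>I. X i \<omega>) \<in> M \<rightarrow>\<^sub>M (\<Pi>\<^sub>M i\<in>I. borel)"
    by (intro measurable_restrict X)
  have mX': "(\<lambda>\<omega>. \<lambda>i\<in>I. X' i \<omega>) \<in> N \<rightarrow>\<^sub>M (\<Pi>\<^sub>M i\<in>I. borel)"
    by (intro measurable_restrict X')
  show "finite_measure (distr M (\<Pi>\<^sub>M i\<in>I. borel) (\<lambda>\<omega>. \<lambda>i\<in>I. X i \<omega>))"
    by (intro M.finite_measure_distr mX)
  fix A :: "'i \<Rightarrow> real set" and J
  assume J: "finite J" "J \<subseteq> I" and A: "\<And>i. i \<in> J \<Longrightarrow> A i \<in> sets borel"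
  let ?E = "prod_emb I (\<lambda>_. borel) J (Pi\<^sub>E J A)"
  have E: "?E \<in> sets (\<Pi>\<^sub>M i\<in>I. borel)"
    using J A by (intro sets_PiM_I) auto
  have [measurable]: "X i \<in> borel_measurable M" "X' i \<in> borel_measurable N" if "i \<in> J" for i
    using X X' J that by auto
  have *: "(\<Prod>j\<in>J. indicator (A j) (f j)) = (indicator {f. \<forall>j\<in>J. f j \<in> A j} f :: real)" for f
    using J by (auto simp: indicator_def prod_zero_iff intro!: prod.neutral)
  \<comment> \<open>Here every coordinate in \<open>J\<close> has been traded for an indicator, so
    the remaining trigonometric sum is empty and its \<open>cis\<close> is 1.\<close>
  have "complex_of_real (LINT \<omega>|M. (\<Prod>j\<in>J. indicator (A j) (X j \<omega>))) =
      complex_of_real (LINT \<omega>|N. (\<Prod>j\<in>J. indicator (A j) (X' j \<omega>)))"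
    using integral_prod_indicator_cis_eq[OF M N J(1), of X X' J A "\<lambda>_. 0"] eq[OF J] A
      \<open>\<And>i. i \<in> J \<Longrightarrow> X i \<in> borel_measurable M\<close> \<open>\<And>i. i \<in> J \<Longrightarrow> X' i \<in> borel_measurable N\<close>
    by (simp del: of_real_prod)
  then have "(LINT \<omega>|M. (\<Prod>j\<in>J. indicator (A j) (X j \<omega>)) :: real) = (LINT \<omega>|N. (\<Prod>j\<in>J. indicator (A j) (X' j \<omega>)))"
    by (simp only: of_real_eq_iff)
  moreover have "(LINT \<omega>|M. (\<Prod>j\<in>J. indicator (A j) (X j \<omega>))) = (LINT \<omega>|M. indicator {\<omega>\<in>space M. \<forall>j\<in>J. X j \<omega> \<in> A j} \<omega> :: real)"
    by (intro Bochner_Integration.integral_cong) (unfold *, auto simp: indicator_def)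
  moreover have "(LINT \<omega>|N. (\<Prod>j\<in>J. indicator (A j) (X' j \<omega>))) = (LINT \<omega>|N. indicator {\<omega>\<in>space N. \<forall>j\<in>J. X' j \<omega> \<in> A j} \<omega> :: real)"
    by (intro Bochner_Integration.integral_cong) (unfold *, auto simp: indicator_def)
  moreover have "{\<omega>\<in>space M. \<forall>j\<in>J. X j \<omega> \<in> A j} \<in> sets M" "{\<omega>\<in>space N. \<forall>j\<in>J. X' j \<omega> \<in> A j} \<in> sets N"
    using J A by (auto intro!: sets.sets_Collect_finite_All')
  ultimately have "M.prob {\<omega>\<in>space M. \<forall>j\<in>J. X j \<omega> \<in> A j} = N.prob {\<omega>\<in>space N. \<forall>j\<in>J. X' j \<omega> \<in> A j}"
    by (simp add: Int_absorb2 Collect_restrict)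
  moreover have "(\<lambda>\<omega>. \<lambda>i\<in>I. X i \<omega>) -` ?E \<inter> space M = {\<omega>\<in>space M. \<forall>j\<in>J. X j \<omega> \<in> A j}"
    "(\<lambda>\<omega>. \<lambda>i\<in>I. X' i \<omega>) -` ?E \<inter> space N = {\<omega>\<in>space N. \<forall>j\<in>J. X' j \<omega> \<in> A j}"
    using J by (auto simp: prod_emb_def PiE_iff subset_eq)
  ultimately show "emeasure (distr M (\<Pi>\<^sub>M i\<in>I. borel) (\<lambda>\<omega>. \<lambda>i\<in>I. X i \<omega>)) ?E =
      emeasure (distr N (\<Pi>\<^sub>M i\<in>I. borel) (\<lambda>\<omega>. \<lambda>i\<in>I. X' i \<omega>)) ?E"
    by (simp add: emeasure_distr[OF mX E] emeasure_distr[OF mX' E] M.emeasure_eq_measure N.emeasure_eq_measure)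
qed simp_all

section \<open>One-dimensional centred Gaussian laws\<close>

lemma distr_std_normal_scale:
  assumes "0 < \<sigma>"
  shows "distr std_normal_distribution borel (\<lambda>x. \<sigma> * x) = density lborel (normal_density 0 \<sigma>)"
proof -
  interpret S: real_distribution std_normal_distribution by (rule real_dist_normal_dist)
  have "distributed std_normal_distribution lborel (\<lambda>x. x) std_normal_density"
    unfolding distributed_def by (auto simp: distr_id2 intro!: measurable_ident_sets)
  from S.normal_density_affine[OF this, of \<sigma> 0] assms
  have "distr std_normal_distribution lborel (\<lambda>x. \<sigma> * x) = density lborel (normal_density 0 \<sigma>)"
    by (simp add: distributed_def)
  moreover have "distr std_normal_distribution lborel (\<lambda>x. \<sigma> * x) = distr std_normal_distribution borel (\<lambda>x. \<sigma> * x)"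
    by (intro distr_cong) auto
  ultimately show ?thesis by simp
qed

lemma std_normal_cis: "(LINT x|std_normal_distribution. cis (s * x)) = exp (- s\<^sup>2 / 2)"
  using char_std_normal_distribution by (simp add: char_def cis_conv_exp fun_eq_iff)

lemma (in prob_space) centered_normal:
  assumes Y: "distributed M lborel Y (normal_density 0 \<sigma>)" and "0 < \<sigma>"
  shows "integrable M Y" "expectation Y = 0" "integrable M (\<lambda>\<omega>. (Y \<omega>)\<^sup>2)" "expectation (\<lambda>\<omega>. (Y \<omega>)\<^sup>2) = \<sigma>\<^sup>2"
    "(LINT \<omega>|M. cis (s * Y \<omega>)) = exp (- (s\<^sup>2 * \<sigma>\<^sup>2) / 2)"
proof -
  have [measurable]: "Y \<in> borel_measurable M" using Y by (auto simp: distributed_def)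
  show "integrable M Y"
    using distributed_integrable[OF Y, of "\<lambda>x. x"] integrable_normal_moment_nz_1[OF \<open>0 < \<sigma>\<close>, of 0] by simp
  show "expectation Y = 0"
    using distributed_integral[OF Y, of "\<lambda>x. x"] integral_normal_moment_nz_1[OF \<open>0 < \<sigma>\<close>, of 0] by simp
  show "integrable M (\<lambda>\<omega>. (Y \<omega>)\<^sup>2)"
    using distributed_integrable[OF Y, of "\<lambda>x. x\<^sup>2"] integrable_normal_moment[OF \<open>0 < \<sigma>\<close>, of 0 2] by simp
  show "expectation (\<lambda>\<omega>. (Y \<omega>)\<^sup>2) = \<sigma>\<^sup>2"
    using distributed_integral[OF Y, of "\<lambda>x. x\<^sup>2"] integral_normal_moment_even[OF \<open>0 < \<sigma>\<close>, of 0 1] by (simp add: fact_numeral)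
  have "distr M borel Y = distr M lborel Y" by (intro distr_cong) auto
  also have "\<dots> = distr std_normal_distribution borel (\<lambda>x. \<sigma> * x)"
    using Y distr_std_normal_scale[OF \<open>0 < \<sigma>\<close>] by (simp add: distributed_def)
  finally have "(LINT x|distr M borel Y. cis (s * x)) = (LINT x|distr std_normal_distribution borel (\<lambda>x. \<sigma> * x). cis (s * x))"
    by simp
  then show "(LINT \<omega>|M. cis (s * Y \<omega>)) = exp (- (s\<^sup>2 * \<sigma>\<^sup>2) / 2)"
    using std_normal_cis[of "s * \<sigma>"]
    by (simp add: integral_distr power_mult_distrib mult.assoc)
qed

text \<open>A centred degenerate variable vanishes almost everywhere, and the formula then holds
  with second moment 0. From here on both kinds of Gaussian law are handled by one
  expression.\<close>

lemma (in prob_space) gaussian_rv_centered: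
  assumes "gaussian_rv M Y" and "expectation Y = 0"
  shows "Y \<in> borel_measurable M" "integrable M (\<lambda>\<omega>. (Y \<omega>)\<^sup>2)"
    "(LINT \<omega>|M. cis (s * Y \<omega>)) = exp (- (s\<^sup>2 * expectation (\<lambda>\<omega>. (Y \<omega>)\<^sup>2)) / 2)"
proof -
  show [measurable]: "Y \<in> borel_measurable M" using assms by (simp add: gaussian_rv_def)
  consider \<mu> \<sigma> where "0 < \<sigma>" "distributed M lborel Y (normal_density \<mu> \<sigma>)" | \<mu> where "AE \<omega> in M. Y \<omega> = \<mu>"
    using assms by (auto simp: gaussian_rv_def)
  then have "integrable M (\<lambda>\<omega>. (Y \<omega>)\<^sup>2) \<and>
    (LINT \<omega>|M. cis (s * Y \<omega>)) = exp (- (s\<^sup>2 * expectation (\<lambda>\<omega>. (Y \<omega>)\<^sup>2)) / 2)"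
  proof cases
    case (1 \<mu> \<sigma>)
    have "expectation Y = \<mu>"
      using distributed_integral[OF 1(2), of "\<lambda>x. x"] integral_normal_moment_nz_1[OF 1(1), of \<mu>] by simp
    with assms 1 have "distributed M lborel Y (normal_density 0 \<sigma>)" by simp
    from centered_normal[OF this \<open>0 < \<sigma>\<close>] show ?thesis by simp
  next
    case (2 \<mu>)
    have "expectation Y = (LINT \<omega>|M. \<mu>)" using 2 by (intro integral_cong_AE) auto
    with assms have "\<mu> = 0" by (simp add: prob_space)
    with 2 have *: "AE \<omega> in M. Y \<omega> = 0" by simp
    have "expectation (\<lambda>\<omega>. (Y \<omega>)\<^sup>2) = (LINT \<omega>|M. 0)" using * by (intro integral_cong_AE) auto
    moreover have "(LINT \<omega>|M. cis (s * Y \<omega>)) = (LINT \<omega>|M. 1)" using * by (intro integral_cong_AE) auto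
    moreover have "integrable M (\<lambda>\<omega>. (Y \<omega>)\<^sup>2)"
      using * by (subst integrable_cong_AE[where g = "\<lambda>_. 0"]) auto
    ultimately show ?thesis by (simp add: prob_space)
  qed
  then show "integrable M (\<lambda>\<omega>. (Y \<omega>)\<^sup>2)"
    "(LINT \<omega>|M. cis (s * Y \<omega>)) = exp (- (s\<^sup>2 * expectation (\<lambda>\<omega>. (Y \<omega>)\<^sup>2)) / 2)" by auto
qed

lemma (in prob_space) normal_of_cis:
  assumes [measurable]: "Y \<in> borel_measurable M" and "0 < v"
    and eq: "\<And>s. (LINT \<omega>|M. cis (s * Y \<omega>)) = complex_of_real (exp (- (s\<^sup>2 * v) / 2))"
  shows "distributed M lborel Y (normal_density 0 (sqrt v))"
proof -
  interpret S: real_distribution std_normal_distribution by (rule real_dist_normal_dist)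
  have "distr M borel Y = distr std_normal_distribution borel (\<lambda>x. sqrt v * x)"
    using std_normal_cis[of "_ * sqrt v"] \<open>0 < v\<close>
    by (intro distr_eq_of_cis_eq prob_space_axioms S.prob_space_axioms)
      (auto simp: eq mult.assoc[symmetric] power_mult_distrib)
  moreover have "distr M borel Y = distr M lborel Y" by (intro distr_cong) auto
  ultimately show ?thesis
    using distr_std_normal_scale[of "sqrt v"] \<open>0 < v\<close> by (simp add: distributed_def)
qed

lemma (in prob_space) zero_of_cis:
  assumes [measurable]: "Y \<in> borel_measurable M"
    and eq: "\<And>s. (LINT \<omega>|M. cis (s * Y \<omega>)) = 1"
  shows "AE \<omega> in M. Y \<omega> = 0"
proof -
  have "distr M borel Y = distr M borel (\<lambda>_. 0)"
    by (intro distr_eq_of_cis_eq prob_space_axioms) (auto simp: eq prob_space)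
  moreover have "AE x in distr M borel (\<lambda>_. 0::real). x = 0"
    by (subst AE_distr_iff) auto
  ultimately have "AE x in distr M borel Y. x = 0" by (simp only:)
  then show ?thesis by (subst (asm) AE_distr_iff) auto
qed

text \<open>The converse of \<open>gaussian_rv_centered\<close>. Integrability and moments are
  conclusions, which matters for a conditional law, where the trigonometric integrals are computed
  before anything is known about moments.\<close>

lemma (in prob_space) gaussian_rv_of_cis:
  assumes [measurable]: "Y \<in> borel_measurable M" and "0 \<le> v"
    and eq: "\<And>s. (LINT \<omega>|M. cis (s * Y \<omega>)) = complex_of_real (exp (- (s\<^sup>2 * v) / 2))"
  shows "gaussian_rv M Y" "integrable M Y" "expectation Y = 0"
    "integrable M (\<lambda>\<omega>. (Y \<omega>)\<^sup>2)" "expectation (\<lambda>\<omega>. (Y \<omega>)\<^sup>2) = v"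
proof -
  have "gaussian_rv M Y \<and> integrable M Y \<and> expectation Y = 0 \<and>
    integrable M (\<lambda>\<omega>. (Y \<omega>)\<^sup>2) \<and> expectation (\<lambda>\<omega>. (Y \<omega>)\<^sup>2) = v"
  proof (cases "v = 0")
    case True
    then have "AE \<omega> in M. Y \<omega> = 0" using eq by (intro zero_of_cis) auto
    moreover from this have "expectation Y = (LINT \<omega>|M. 0)" "expectation (\<lambda>\<omega>. (Y \<omega>)\<^sup>2) = (LINT \<omega>|M. 0)"
      by (intro integral_cong_AE; auto)+
    moreover from calculation(1) have "integrable M Y" "integrable M (\<lambda>\<omega>. (Y \<omega>)\<^sup>2)"
      by (subst integrable_cong_AE[where g = "\<lambda>_. 0"]; auto)+
    ultimately show ?thesis using True by (auto simp: gaussian_rv_def)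
  next
    case False
    with \<open>0 \<le> v\<close> have "0 < v" by simp
    with normal_of_cis[OF _ this eq] have D: "distributed M lborel Y (normal_density 0 (sqrt v))" by simp
    show ?thesis
      using centered_normal[OF D] \<open>0 < v\<close> D by (auto simp: gaussian_rv_def intro: real_sqrt_gt_zero)
  qed
  then show "gaussian_rv M Y" "integrable M Y" "expectation Y = 0"
    "integrable M (\<lambda>\<omega>. (Y \<omega>)\<^sup>2)" "expectation (\<lambda>\<omega>. (Y \<omega>)\<^sup>2) = v" by auto
qed

subsection \<open>Gaussian spaces\<close>

text \<open>
  Unlike \<open>indep_var\<close>, this does not force the two random variables to have the same type.
\<close>

definition indep_pair ::
    "'a measure \<Rightarrow> 's measure \<Rightarrow> ('a \<Rightarrow> 's) \<Rightarrow> 't measure \<Rightarrow> ('a \<Rightarrow> 't) \<Rightarrow> bool" where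
  "indep_pair M S G T V \<longleftrightarrow> G \<in> M \<rightarrow>\<^sub>M S \<and> V \<in> M \<rightarrow>\<^sub>M T \<and>
     distr M S G \<Otimes>\<^sub>M distr M T V = distr M (S \<Otimes>\<^sub>M T) (\<lambda>\<omega>. (G \<omega>, V \<omega>))"

lemma (in prob_space) indep_pair_compose:
  assumes "indep_pair M S G T V" and f: "f \<in> S \<rightarrow>\<^sub>M S'" and g: "g \<in> T \<rightarrow>\<^sub>M T'"
  shows "indep_pair M S' (\<lambda>\<omega>. f (G \<omega>)) T' (\<lambda>\<omega>. g (V \<omega>))"
proof -
  have [measurable]: "G \<in> M \<rightarrow>\<^sub>M S" "V \<in> M \<rightarrow>\<^sub>M T"
    and eq: "distr M S G \<Otimes>\<^sub>M distr M T V = distr M (S \<Otimes>\<^sub>M T) (\<lambda>\<omega>. (G \<omega>, V \<omega>))"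
    using assms by (auto simp: indep_pair_def)
  note [measurable] = f g
  have "distr M S' (\<lambda>\<omega>. f (G \<omega>)) \<Otimes>\<^sub>M distr M T' (\<lambda>\<omega>. g (V \<omega>)) = distr (distr M S G) S' f \<Otimes>\<^sub>M distr (distr M T V) T' g"
    by (simp add: distr_distr comp_def)
  also have "\<dots> = distr (distr M S G \<Otimes>\<^sub>M distr M T V) (S' \<Otimes>\<^sub>M T') (\<lambda>(x, y). (f x, g y))"
    by (intro pair_measure_distr prob_space_imp_sigma_finite prob_space.prob_space_distr prob_space_distr) auto
  also have "\<dots> = distr M (S' \<Otimes>\<^sub>M T') (\<lambda>\<omega>. (f (G \<omega>), g (V \<omega>)))"
    unfolding eq by (subst distr_distr) (auto simp: comp_def)
  finally show ?thesis by (simp add: indep_pair_def)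
qed

lemma integrable_mult_of_squares:
  fixes Y Y' :: "'a \<Rightarrow> real"
  assumes "Y \<in> borel_measurable M" "Y' \<in> borel_measurable M"
    and "integrable M (\<lambda>\<omega>. (Y \<omega>)\<^sup>2)" "integrable M (\<lambda>\<omega>. (Y' \<omega>)\<^sup>2)"
  shows "integrable M (\<lambda>\<omega>. Y \<omega> * Y' \<omega>)"
proof (rule Bochner_Integration.integrable_bound)
  show "integrable M (\<lambda>\<omega>. (Y \<omega>)\<^sup>2 + (Y' \<omega>)\<^sup>2)"
    using assms by (intro Bochner_Integration.integrable_add)
  show "(\<lambda>\<omega>. Y \<omega> * Y' \<omega>) \<in> borel_measurable M"
    using assms by (intro borel_measurable_times)
  have "\<bar>a * b\<bar> \<le> a\<^sup>2 + b\<^sup>2" for a b :: real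
    using sum_squares_bound[of "\<bar>a\<bar>" "\<bar>b\<bar>"] mult_nonneg_nonneg[of "\<bar>a\<bar>" "\<bar>b\<bar>"]
    unfolding abs_mult by (simp only: power2_abs) linarith
  then show "AE \<omega> in M. norm (Y \<omega> * Y' \<omega>) \<le> norm ((Y \<omega>)\<^sup>2 + (Y' \<omega>)\<^sup>2)"
    by simp
qed

text \<open>A linear space of centred, jointly Gaussian variables. Frequency 1 is enough in
  \<open>cis_H\<close>, since \<open>scale_H\<close> supplies the others; joint Gaussianity is
  closure under linear combinations, and mean zero follows in \<open>expectation_H\<close>.\<close>

locale gaussian_space = prob_space M for M :: "'a measure" +
  fixes H :: "('a \<Rightarrow> real) set"
  assumes measurable_H: "Y \<in> H \<Longrightarrow> Y \<in> borel_measurable M"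
    and integrable_square_H: "Y \<in> H \<Longrightarrow> integrable M (\<lambda>\<omega>. (Y \<omega>)\<^sup>2)"
    and cis_H: "Y \<in> H \<Longrightarrow> (LINT \<omega>|M. cis (Y \<omega>)) = exp (- (LINT \<omega>|M. (Y \<omega>)\<^sup>2) / 2)"
    and zero_H: "(\<lambda>_. 0) \<in> H"
    and add_H: "Y \<in> H \<Longrightarrow> Y' \<in> H \<Longrightarrow> (\<lambda>\<omega>. Y \<omega> + Y' \<omega>) \<in> H"
    and scale_H: "Y \<in> H \<Longrightarrow> (\<lambda>\<omega>. c * Y \<omega>) \<in> H"
begin

text \<open>The mixed second moment is the covariance on \<open>H\<close>, whose members have mean
  zero.\<close>

definition cov :: "('a \<Rightarrow> real) \<Rightarrow> ('a \<Rightarrow> real) \<Rightarrow> real" where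
  "cov Y Y' = expectation (\<lambda>\<omega>. Y \<omega> * Y' \<omega>)"

lemma diff_H: "Y \<in> H \<Longrightarrow> Y' \<in> H \<Longrightarrow> (\<lambda>\<omega>. Y \<omega> - Y' \<omega>) \<in> H"
  using add_H[of Y "\<lambda>\<omega>. (- 1) * Y' \<omega>"] scale_H[of Y' "- 1"] by simp

lemma sum_H: "(\<And>i. i \<in> I \<Longrightarrow> Y i \<in> H) \<Longrightarrow> (\<lambda>\<omega>. \<Sum>i\<in>I. Y i \<omega>) \<in> H"
  by (induction I rule: infinite_finite_induct) (simp_all add: zero_H add_H)

lemma integrable_mult_H: "Y \<in> H \<Longrightarrow> Y' \<in> H \<Longrightarrow> integrable M (\<lambda>\<omega>. Y \<omega> * Y' \<omega>)"
  by (intro integrable_mult_of_squares measurable_H integrable_square_H)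

lemma cov_commute: "cov Y Y' = cov Y' Y"
  by (simp add: cov_def mult.commute)

lemma cov_add_left: "Y \<in> H \<Longrightarrow> Y' \<in> H \<Longrightarrow> V \<in> H \<Longrightarrow>
    cov (\<lambda>\<omega>. Y \<omega> + Y' \<omega>) V = cov Y V + cov Y' V"
  by (simp add: cov_def ring_distribs integrable_mult_H)

lemma cov_diff_left: "Y \<in> H \<Longrightarrow> Y' \<in> H \<Longrightarrow> V \<in> H \<Longrightarrow>
    cov (\<lambda>\<omega>. Y \<omega> - Y' \<omega>) V = cov Y V - cov Y' V"
  by (simp add: cov_def left_diff_distrib integrable_mult_H)

lemma cov_scale_left: "cov (\<lambda>\<omega>. c * Y \<omega>) V = c * cov Y V"
  by (simp add: cov_def mult.assoc)

lemma cov_sum_left: "(\<And>i. i \<in> I \<Longrightarrow> Y i \<in> H) \<Longrightarrow> V \<in> H \<Longrightarrow>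
    cov (\<lambda>\<omega>. \<Sum>i\<in>I. Y i \<omega>) V = (\<Sum>i\<in>I. cov (Y i) V)"
  by (simp add: cov_def sum_distrib_right integrable_mult_H)

lemmas cov_add_right = cov_add_left[folded cov_commute[of V for V]]

lemma cov_diff_right: "Y \<in> H \<Longrightarrow> Y' \<in> H \<Longrightarrow> V \<in> H \<Longrightarrow>
    cov V (\<lambda>\<omega>. Y \<omega> - Y' \<omega>) = cov V Y - cov V Y'"
  using cov_diff_left[of Y Y' V] by (simp only: cov_commute)

lemma cov_scale_right: "cov V (\<lambda>\<omega>. c * Y \<omega>) = c * cov V Y"
  using cov_scale_left[of c Y V] by (simp only: cov_commute)

lemma cov_sum_right: "(\<And>i. i \<in> I \<Longrightarrow> Y i \<in> H) \<Longrightarrow> V \<in> H \<Longrightarrow>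
    cov V (\<lambda>\<omega>. \<Sum>i\<in>I. Y i \<omega>) = (\<Sum>i\<in>I. cov V (Y i))"
  using cov_sum_left[of I Y V] by (simp only: cov_commute)

lemma cov_nonneg: "0 \<le> cov Y Y"
  by (simp add: cov_def)

lemma cis_cov: "Y \<in> H \<Longrightarrow> (LINT \<omega>|M. cis (Y \<omega>)) = exp (- cov Y Y / 2)"
  by (simp add: cov_def cis_H power2_eq_square)

lemma cis_scale_cov: "Y \<in> H \<Longrightarrow> (LINT \<omega>|M. cis (s * Y \<omega>)) = exp (- (s\<^sup>2 * cov Y Y) / 2)"
  using cis_cov[OF scale_H[of Y s]] by (simp add: cov_scale_left cov_scale_right power2_eq_square mult.assoc)

lemma gaussian_rv_H: "Y \<in> H \<Longrightarrow> gaussian_rv M Y"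
  and integrable_H: "Y \<in> H \<Longrightarrow> integrable M Y"
  and expectation_H: "Y \<in> H \<Longrightarrow> expectation Y = 0"
  using gaussian_rv_of_cis[OF measurable_H cov_nonneg cis_scale_cov] by blast+

lemma AE_zero_H:
  assumes "Y \<in> H" "cov Y Y = 0" shows "AE \<omega> in M. Y \<omega> = 0"
  using cis_scale_cov[OF assms(1)] assms by (intro zero_of_cis measurable_H) auto

lemma normal_H: "Y \<in> H \<Longrightarrow> 0 < cov Y Y \<Longrightarrow> distributed M lborel Y (normal_density 0 (sqrt (cov Y Y)))"
  by (intro normal_of_cis measurable_H cis_scale_cov)

lemma cov_linear_combination:
  assumes "\<And>i. i \<in> I \<Longrightarrow> Y i \<in> H"
  shows "cov (\<lambda>\<omega>. \<Sum>i\<in>I. a i * Y i \<omega>) (\<lambda>\<omega>. \<Sum>i\<in>I. a i * Y i \<omega>) = (\<Sum>i\<in>I. \<Sum>j\<in>I. a i * a j * cov (Y i) (Y j))"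
  using assms
  by (simp add: cov_sum_left cov_sum_right sum_H scale_H cov_scale_left cov_scale_right
      sum_distrib_left mult.assoc)

text \<open>When the mixed covariances vanish, the variance of a sum of a
  \<open>P\<close>-combination and a \<open>Q\<close>-combination splits, so its trigonometric
  integral factors as it does for independent copies. The index sets are arbitrary, so that whole
  pasts and whole paths can be treated.\<close>

lemma indep_of_uncorrelated:
  fixes P :: "'s \<Rightarrow> 'a \<Rightarrow> real" and Q :: "'t \<Rightarrow> 'a \<Rightarrow> real"
  assumes P: "\<And>s. s \<in> S \<Longrightarrow> P s \<in> H" and Q: "\<And>t. t \<in> T \<Longrightarrow> Q t \<in> H"
    and PQ: "\<And>s t. s \<in> S \<Longrightarrow> t \<in> T \<Longrightarrow> cov (P s) (Q t) = 0"
  shows "indep_pair M (\<Pi>\<^sub>M s\<in>S. borel) (\<lambda>\<omega>. \<lambda>s\<in>S. P s \<omega>) (\<Pi>\<^sub>M t\<in>T. borel) (\<lambda>\<omega>. \<lambda>t\<in>T. Q t \<omega>)"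
proof -
  interpret MM: pair_prob_space M M ..
  let ?S = "\<Pi>\<^sub>M s\<in>S. borel :: real measure" and ?T = "\<Pi>\<^sub>M t\<in>T. borel :: real measure"
  let ?ST = "\<Pi>\<^sub>M i\<in>S <+> T. borel :: real measure"
  let ?P = "\<lambda>\<omega>. \<lambda>s\<in>S. P s \<omega>" and ?Q = "\<lambda>\<omega>. \<lambda>t\<in>T. Q t \<omega>"
  \<comment> \<open>\<open>R\<close> describes the joint law on \<open>M\<close>, while
    \<open>R'\<close> takes the \<open>P\<close>-part and the \<open>Q\<close>-part from separate
    coordinates of the product space, that is, from independent copies. The disjoint sum
    \<open>S <+> T\<close> turns the comparison into one about a single family, and
    \<open>\<phi>\<close> splits it into a pair again.\<close>
  define R where "R = (\<lambda>i \<omega>. case i of Inl s \<Rightarrow> P s \<omega> | Inr t \<Rightarrow> Q t \<omega>)"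
  define R' where "R' = (\<lambda>i (\<omega>, \<omega>'). case i of Inl s \<Rightarrow> P s \<omega> | Inr t \<Rightarrow> Q t \<omega>')"
  define \<phi> where "\<phi> = (\<lambda>f :: 's + 't \<Rightarrow> real. (\<lambda>s\<in>S. f (Inl s), \<lambda>t\<in>T. f (Inr t)))"
  have mP: "?P \<in> M \<rightarrow>\<^sub>M ?S" by (intro measurable_restrict measurable_H P)
  have mQ: "?Q \<in> M \<rightarrow>\<^sub>M ?T" by (intro measurable_restrict measurable_H Q)
  have R: "R i \<in> borel_measurable M" if "i \<in> S <+> T" for i
    using that P Q by (auto simp: R_def intro: measurable_H)
  have R': "R' i \<in> borel_measurable (M \<Otimes>\<^sub>M M)" if "i \<in> S <+> T" for i
    using that measurable_H[OF P] measurable_H[OF Q] by (auto simp: R'_def split_beta)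
  have \<phi>: "\<phi> \<in> ?ST \<rightarrow>\<^sub>M ?S \<Otimes>\<^sub>M ?T"
    unfolding \<phi>_def by (intro measurable_Pair measurable_restrict measurable_component_singleton) auto
  have "distr M ?ST (\<lambda>\<omega>. \<lambda>i\<in>S <+> T. R i \<omega>) = distr (M \<Otimes>\<^sub>M M) ?ST (\<lambda>\<omega>. \<lambda>i\<in>S <+> T. R' i \<omega>)"
  proof (rule distr_PiM_eq_of_cis_eq[OF prob_space_axioms MM.prob_space_axioms R R'])
    fix J :: "('s + 't) set" and a :: "'s + 't \<Rightarrow> real" assume J: "finite J" "J \<subseteq> S <+> T"
    define A where "A = Inl -` J" define B where "B = Inr -` J"
    have AB: "J = A <+> B" "A \<subseteq> S" "B \<subseteq> T"
      using J(2) by (auto simp: A_def B_def Plus_def)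
    have fin: "finite A" "finite B" using J(1) AB(1) by (simp_all add: finite_Plus_iff)
    define p where "p = (\<lambda>\<omega>. \<Sum>s\<in>A. a (Inl s) * P s \<omega>)"
    define q where "q = (\<lambda>\<omega>. \<Sum>t\<in>B. a (Inr t) * Q t \<omega>)"
    have pq: "p \<in> H" "q \<in> H"
      unfolding p_def q_def using P Q AB by (auto intro!: sum_H scale_H)
    note [measurable] = measurable_H[OF pq(1)] measurable_H[OF pq(2)]
    have "cov p q = 0"
      using P Q PQ AB unfolding p_def q_def
      by (subst cov_sum_left)
        (auto intro!: sum_H scale_H sum.neutral simp: cov_sum_right cov_scale_left cov_scale_right scale_H subset_eq)
    then have "cov (\<lambda>\<omega>. p \<omega> + q \<omega>) (\<lambda>\<omega>. p \<omega> + q \<omega>) = cov p p + cov q q"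
      using pq by (simp add: cov_add_left cov_add_right add_H cov_commute[of q p])
    then have "(LINT \<omega>|M. cis (p \<omega> + q \<omega>)) = (LINT \<omega>|M. cis (p \<omega>)) * (LINT \<omega>|M. cis (q \<omega>))"
      using pq by (simp add: cis_cov add_H) (simp add: exp_add[symmetric] of_real_exp[symmetric] of_real_mult[symmetric] add_divide_distrib del: of_real_mult)
    also have "\<dots> = (LINT \<omega>|(M \<Otimes>\<^sub>M M). cis (p (fst \<omega>) + q (snd \<omega>)))"
    proof -
      have "integrable (M \<Otimes>\<^sub>M M) (\<lambda>\<omega>. cis (p (fst \<omega>) + q (snd \<omega>)))"
        by (intro MM.integrable_cis) measurable
      from MM.integral_fst'[OF this] show ?thesis
        by (simp add: cis_mult[symmetric])
    qed
    finally show "(LINT \<omega>|M. cis (\<Sum>i\<in>J. a i * R i \<omega>)) = (LINT \<omega>|(M \<Otimes>\<^sub>M M). cis (\<Sum>i\<in>J. a i * R' i \<omega>))"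
      unfolding AB(1) using fin by (simp add: sum.Plus R_def R'_def p_def q_def split_beta)
  qed
  then have "distr (distr M ?ST (\<lambda>\<omega>. \<lambda>i\<in>S <+> T. R i \<omega>)) (?S \<Otimes>\<^sub>M ?T) \<phi> =
      distr (distr (M \<Otimes>\<^sub>M M) ?ST (\<lambda>\<omega>. \<lambda>i\<in>S <+> T. R' i \<omega>)) (?S \<Otimes>\<^sub>M ?T) \<phi>"
    by simp
  then have "distr M (?S \<Otimes>\<^sub>M ?T) (\<lambda>\<omega>. (?P \<omega>, ?Q \<omega>)) =
      distr (M \<Otimes>\<^sub>M M) (?S \<Otimes>\<^sub>M ?T) (\<lambda>(\<omega>, \<omega>'). (?P \<omega>, ?Q \<omega>'))"
    using R R' by (subst (asm) (1 2) distr_distr)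
      (auto intro!: \<phi> measurable_restrict simp: comp_def \<phi>_def R_def R'_def split_beta' InlI InrI cong: restrict_cong)
  also have "\<dots> = distr M ?S ?P \<Otimes>\<^sub>M distr M ?T ?Q"
    using mP mQ prob_space_imp_sigma_finite[OF prob_space_distr[OF mQ]]
    by (intro pair_measure_distr[symmetric])
  finally show ?thesis
    unfolding indep_pair_def using mP mQ by simp
qed

end

text \<open>Freezing: by independence the joint law of \<open>G\<close> and \<open>V\<close> is a
  product, so Fubini integrates \<open>V\<close> out with the value of \<open>G\<close> held fixed.
  \<open>G\<close> has values in any measurable space and can therefore be the entire past of a
  process or its present value.\<close>

lemma (in prob_space) real_cond_exp_add_indep:
  fixes V :: "'a \<Rightarrow> real"
  assumes ind: "indep_pair M S G borel V" and [measurable]: "g \<in> borel_measurable S" "B \<in> sets borel"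
  shows "AE \<omega> in M. real_cond_exp M (vimage_algebra (space M) G S) (\<lambda>\<omega>. indicator B (g (G \<omega>) + V \<omega>)) \<omega> =
    (LINT v|distr M borel V. indicator B (g (G \<omega>) + v))"
proof -
  let ?F = "vimage_algebra (space M) G S"
  have G[measurable]: "G \<in> M \<rightarrow>\<^sub>M S" and V[measurable]: "V \<in> borel_measurable M"
    and prod: "distr M S G \<Otimes>\<^sub>M distr M borel V = distr M (S \<Otimes>\<^sub>M borel) (\<lambda>\<omega>. (G \<omega>, V \<omega>))"
    using ind unfolding indep_pair_def by auto
  have G': "G \<in> space M \<rightarrow> space S" using measurable_space[OF G] by auto
  have "subalgebra M ?F"
    using measurable_sets[OF G] by (auto simp: subalgebra_def sets_vimage_algebra2[OF G'])
  then interpret F: finite_measure_subalgebra M ?F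
    by unfold_locales
  interpret V: prob_space "distr M borel V" by (rule prob_space_distr) simp
  interpret DG: prob_space "distr M S G" by (rule prob_space_distr) simp
  interpret GV: pair_prob_space "distr M S G" "distr M borel V" ..
  define q where "q = (\<lambda>x. LINT v|distr M borel V. indicator B (g x + v) :: real)"
  have q[measurable]: "q \<in> borel_measurable S"
    unfolding q_def by measurable
  have q_le: "\<bar>q x\<bar> \<le> 1" for x
  proof -
    have "norm (q x) \<le> (LINT v|distr M borel V. norm (indicator B (g x + v) :: real))"
      unfolding q_def by (rule integral_norm_bound)
    also have "\<dots> \<le> (LINT v|distr M borel V. 1)"
      by (intro integral_mono V.integrable_const_bound[of _ 1]) (auto split: split_indicator)
    finally show ?thesis using V.prob_space by simp
  qed
  have "AE \<omega> in M. real_cond_exp M ?F (\<lambda>\<omega>. indicator B (g (G \<omega>) + V \<omega>)) \<omega> = q (G \<omega>)"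
  proof (rule F.real_cond_exp_charact)
    show "integrable M (\<lambda>\<omega>. indicator B (g (G \<omega>) + V \<omega>) :: real)"
      by (intro integrable_const_bound[of _ 1]) (auto split: split_indicator)
    show "integrable M (\<lambda>\<omega>. q (G \<omega>))"
      using q_le by (intro integrable_const_bound[of _ 1]) auto
    show "(\<lambda>\<omega>. q (G \<omega>)) \<in> borel_measurable ?F"
      using measurable_comp[OF measurable_vimage_algebra1[OF G'] q] by (simp add: comp_def)
    fix A assume "A \<in> sets ?F"
    then obtain A' where [measurable]: "A' \<in> sets S" and A: "A = G -` A' \<inter> space M"
      unfolding sets_vimage_algebra2[OF G'] by auto
    let ?f = "\<lambda>x v. indicator A' x * indicator B (g x + v) :: real"
    have "(LINT \<omega>:A|M. indicator B (g (G \<omega>) + V \<omega>) :: real) = (LINT \<omega>|M. ?f (G \<omega>) (V \<omega>))"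
      unfolding set_lebesgue_integral_def A by (intro Bochner_Integration.integral_cong) (auto split: split_indicator)
    also have "\<dots> = (LINT y|distr M (S \<Otimes>\<^sub>M borel) (\<lambda>\<omega>. (G \<omega>, V \<omega>)). ?f (fst y) (snd y))"
      by (subst integral_distr) auto
    also have "\<dots> = (LINT y|(distr M S G \<Otimes>\<^sub>M distr M borel V). ?f (fst y) (snd y))"
      unfolding prod ..
    also have "\<dots> = (LINT x|distr M S G. LINT v|distr M borel V. ?f x v)"
    proof -
      have "integrable (distr M S G \<Otimes>\<^sub>M distr M borel V) (\<lambda>y. ?f (fst y) (snd y))"
        by (intro GV.integrable_const_bound[of _ 1]) (auto split: split_indicator)
      from GV.integral_fst'[OF this] show ?thesis by simp
    qed
    also have "\<dots> = (LINT x|distr M S G. indicator A' x * q x)"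
      by (simp add: q_def)
    also have "\<dots> = (LINT \<omega>|M. indicator A' (G \<omega>) * q (G \<omega>))"
      by (subst integral_distr) auto
    also have "\<dots> = (LINT \<omega>:A|M. q (G \<omega>))"
      unfolding set_lebesgue_integral_def A by (intro Bochner_Integration.integral_cong) (auto split: split_indicator)
    finally show "(LINT \<omega>:A|M. indicator B (g (G \<omega>) + V \<omega>) :: real) = (LINT \<omega>:A|M. q (G \<omega>))" .
  qed
  then show ?thesis by (simp add: q_def)
qed

subsection \<open>Gaussian processes\<close>

definition process_span :: "real set \<Rightarrow> (real \<Rightarrow> 'a \<Rightarrow> real) \<Rightarrow> ('a \<Rightarrow> real) set" where
  "process_span T X = {\<lambda>\<omega>. \<Sum>t\<in>I. a t * X t \<omega> | I a. finite I \<and> I \<subseteq> T}"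

lemma process_spanI: "finite I \<Longrightarrow> I \<subseteq> T \<Longrightarrow> (\<lambda>\<omega>. \<Sum>t\<in>I. a t * X t \<omega>) \<in> process_span T X"
  by (auto simp: process_span_def)

lemma process_span_component: "t \<in> T \<Longrightarrow> X t \<in> process_span T X"
  using process_spanI[of "{t}" T "\<lambda>_. 1" X] by simp

lemma process_span_add:
  assumes "Y \<in> process_span T X" "Y' \<in> process_span T X"
  shows "(\<lambda>\<omega>. Y \<omega> + Y' \<omega>) \<in> process_span T X"
proof -
  obtain I a I' a' where I: "finite I" "I \<subseteq> T" "finite I'" "I' \<subseteq> T"
    and Y: "Y = (\<lambda>\<omega>. \<Sum>t\<in>I. a t * X t \<omega>)" "Y' = (\<lambda>\<omega>. \<Sum>t\<in>I'. a' t * X t \<omega>)"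
    using assms by (auto simp: process_span_def)
  have "(\<Sum>t\<in>I. a t * X t \<omega>) = (\<Sum>t\<in>I \<union> I'. (if t \<in> I then a t else 0) * X t \<omega>)" for \<omega>
    using I by (intro sum.mono_neutral_cong_left) auto
  moreover have "(\<Sum>t\<in>I'. a' t * X t \<omega>) = (\<Sum>t\<in>I \<union> I'. (if t \<in> I' then a' t else 0) * X t \<omega>)" for \<omega>
    using I by (intro sum.mono_neutral_cong_left) auto
  ultimately have "(\<lambda>\<omega>. Y \<omega> + Y' \<omega>) =
      (\<lambda>\<omega>. \<Sum>t\<in>I \<union> I'. ((if t \<in> I then a t else 0) + (if t \<in> I' then a' t else 0)) * X t \<omega>)"
    unfolding Y by (simp add: sum.distrib distrib_right)
  then show ?thesis using I by (auto intro!: process_spanI)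
qed

lemma (in prob_space) gaussian_space_process_span:
  assumes gauss: "gaussian_process M T X" and mean: "\<And>t. t \<in> T \<Longrightarrow> expectation (X t) = 0"
  shows "gaussian_space M (process_span T X)"
proof -
  have rv: "gaussian_rv M Y" if "Y \<in> process_span T X" for Y
    using that gauss by (auto simp: process_span_def gaussian_process_def)
  have int: "integrable M (X t)" if "t \<in> T" for t
    using gaussian_rv_centered(1,2)[OF rv[OF process_span_component[where X = X, OF that]] mean[OF that]]
    by (rule square_integrable_imp_integrable)
  have "expectation Y = 0" if Y: "Y \<in> process_span T X" for Y
  proof -
    obtain I a where I: "I \<subseteq> T" and Y: "Y = (\<lambda>\<omega>. \<Sum>t\<in>I. a t * X t \<omega>)"
      using Y by (auto simp: process_span_def)
    have "expectation Y = (\<Sum>t\<in>I. expectation (\<lambda>\<omega>. a t * X t \<omega>))"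
      unfolding Y using I int by (intro Bochner_Integration.integral_sum integrable_mult_right) auto
    also have "\<dots> = 0" using I mean by (intro sum.neutral) auto
    finally show ?thesis .
  qed
  note centered = gaussian_rv_centered[OF rv this]
  show ?thesis
  proof (unfold_locales, goal_cases)
    case (1 Y) then show ?case using centered(1)[of Y] by simp
  next
    case (2 Y) then show ?case using centered(2)[of Y] by simp
  next
    case (3 Y) then show ?case using centered(3)[of Y 1] by simp
  next
    case 4 show ?case using process_spanI[of "{}"] by simp
  next
    case (5 Y Y') then show ?case by (rule process_span_add)
  next
    case (6 Y c)
    then obtain I a where "finite I" "I \<subseteq> T" "Y = (\<lambda>\<omega>. \<Sum>t\<in>I. a t * X t \<omega>)"
      by (auto simp: process_span_def)
    then show ?case using process_spanI[of I T "\<lambda>t. c * a t" X]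
      by (simp add: sum_distrib_left mult.assoc)
  qed
qed

lemma (in prob_space) cov_indep_spaces:
  fixes H :: "'n \<Rightarrow> ('a \<Rightarrow> real) set"
  assumes G: "\<And>i. gaussian_space M (H i)"
    and ind: "\<And>Y. (\<And>i. Y i \<in> H i) \<Longrightarrow> indep_vars (\<lambda>_. borel) Y UNIV"
    and "i \<noteq> j" "Y \<in> H i" "Y' \<in> H j"
  shows "expectation (\<lambda>\<omega>. Y \<omega> * Y' \<omega>) = 0"
proof -
  interpret G: gaussian_space M "H l" for l by (rule G)
  \<comment> \<open>Independence is given for families with one member from every
    \<open>H l\<close>, so the two variables are padded with zeros.\<close>
  let ?Y = "\<lambda>l. if l = i then Y else if l = j then Y' else (\<lambda>_. 0)"
  have "indep_vars (\<lambda>_. borel) ?Y UNIV"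
  proof (rule ind)
    fix l
    show "?Y l \<in> H l"
      using assms(4,5) G.zero_H[of l] by simp
  qed
  then have "indep_vars (\<lambda>_. borel) ?Y {i, j}" by (rule indep_vars_subset) simp
  then have "expectation (\<lambda>\<omega>. \<Prod>l\<in>{i, j}. ?Y l \<omega>) = (\<Prod>l\<in>{i, j}. expectation (?Y l))"
  proof (rule indep_vars_lebesgue_integral[rotated])
    fix l assume "l \<in> {i, j}"
    then show "integrable M (?Y l)" using assms(4,5) by (auto intro: G.integrable_H)
  qed simp
  then show ?thesis using assms(3-5) by (simp add: G.expectation_H)
qed

text \<open>Characteristic functions of independent summands multiply, and the variances in the
  exponents add because the mixed terms vanish by \<open>cov_indep_spaces\<close>. This is where
  separately Gaussian processes become jointly Gaussian.\<close>

lemma (in prob_space) gaussian_space_indep_sum: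
  fixes H :: "'n::finite \<Rightarrow> ('a \<Rightarrow> real) set"
  assumes G: "\<And>i. gaussian_space M (H i)"
    and ind: "\<And>Y. (\<And>i. Y i \<in> H i) \<Longrightarrow> indep_vars (\<lambda>_. borel) Y UNIV"
  shows "gaussian_space M {\<lambda>\<omega>. \<Sum>i\<in>UNIV. Y i \<omega> | Y. \<forall>i. Y i \<in> H i}"
proof -
  interpret G: gaussian_space M "H l" for l by (rule G)
  show ?thesis
  proof (unfold_locales, goal_cases)
    case (1 S)
    then obtain Y where Y: "S = (\<lambda>\<omega>. \<Sum>i\<in>UNIV. Y i \<omega>)" "\<And>i. Y i \<in> H i" by auto
    show ?case unfolding Y(1) by (intro borel_measurable_sum G.measurable_H[OF Y(2)])
  next
    case (2 S)
    then obtain Y where Y: "S = (\<lambda>\<omega>. \<Sum>i\<in>UNIV. Y i \<omega>)" "\<And>i. Y i \<in> H i" by auto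
    have "integrable M (\<lambda>\<omega>. Y i \<omega> * Y j \<omega>)" for i j
      by (intro integrable_mult_of_squares G.measurable_H[OF Y(2)] G.integrable_square_H[OF Y(2)])
    then show ?case unfolding Y(1) by (simp add: power2_eq_square sum_product)
  next
    case (3 S)
    then obtain Y where Y: "S = (\<lambda>\<omega>. \<Sum>i\<in>UNIV. Y i \<omega>)" "\<And>i. Y i \<in> H i" by auto
    note [measurable] = G.measurable_H[OF Y(2)]
    have YY: "integrable M (\<lambda>\<omega>. Y i \<omega> * Y j \<omega>)" for i j
      by (intro integrable_mult_of_squares G.measurable_H[OF Y(2)] G.integrable_square_H[OF Y(2)])
    have orth: "(LINT \<omega>|M. Y i \<omega> * Y j \<omega>) = 0" if "i \<noteq> j" for i j
      by (rule cov_indep_spaces[OF G _ that Y(2) Y(2)]) (rule ind)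
    have "(LINT \<omega>|M. (S \<omega>)\<^sup>2) = (\<Sum>i\<in>UNIV. \<Sum>j\<in>UNIV. LINT \<omega>|M. Y i \<omega> * Y j \<omega>)"
      unfolding Y(1) power2_eq_square sum_product using YY by simp
    also have "\<dots> = (\<Sum>i\<in>UNIV. \<Sum>j\<in>UNIV. if j = i then LINT \<omega>|M. Y i \<omega> * Y i \<omega> else 0)"
      by (intro sum.cong) (auto simp: orth)
    also have "\<dots> = (\<Sum>i\<in>UNIV. LINT \<omega>|M. (Y i \<omega>)\<^sup>2)"
      by (simp add: power2_eq_square)
    finally have sq: "(LINT \<omega>|M. (S \<omega>)\<^sup>2) = (\<Sum>i\<in>UNIV. LINT \<omega>|M. (Y i \<omega>)\<^sup>2)" .
    have "(LINT \<omega>|M. cis (S \<omega>)) = char (distr M borel S) 1"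
      unfolding Y(1) by (subst char_distr_eq_cis) simp_all
    also have "\<dots> = (\<Prod>i\<in>UNIV. char (distr M borel (Y i)) 1)"
      unfolding Y(1) by (intro char_distr_sum ind Y(2))
    also have "\<dots> = (\<Prod>i\<in>UNIV. complex_of_real (exp (- (LINT \<omega>|M. (Y i \<omega>)\<^sup>2) / 2)))"
      by (intro prod.cong refl) (simp add: char_distr_eq_cis G.cis_H[OF Y(2)])
    also have "\<dots> = exp (- (LINT \<omega>|M. (S \<omega>)\<^sup>2) / 2)"
      unfolding sq by (simp add: exp_sum sum_divide_distrib flip: of_real_prod sum_negf)
    finally show ?case .
  next
    case 4 show ?case by (auto intro!: exI[of _ "\<lambda>_ _. 0"] G.zero_H)
  next
    case (5 S S')
    then obtain Y Y' where "S = (\<lambda>\<omega>. \<Sum>i\<in>UNIV. Y i \<omega>)" "\<And>i. Y i \<in> H i"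
      "S' = (\<lambda>\<omega>. \<Sum>i\<in>UNIV. Y' i \<omega>)" "\<And>i. Y' i \<in> H i" by auto
    then show ?case
      by (auto intro!: exI[of _ "\<lambda>i \<omega>. Y i \<omega> + Y' i \<omega>"] G.add_H simp: sum.distrib)
  next
    case (6 S c)
    then obtain Y where "S = (\<lambda>\<omega>. \<Sum>i\<in>UNIV. Y i \<omega>)" "\<And>i. Y i \<in> H i" by auto
    then show ?case
      by (auto intro!: exI[of _ "\<lambda>i \<omega>. c * Y i \<omega>"] G.scale_H simp: sum_distrib_left)
  qed
qed

lemma time_dom_real: "time_dom (ereal w) = {0..<w}"
  by (auto simp: time_dom_def)

section \<open>Markov property, stationarity and the GMSI property derived from covariances\<close>

context gaussian_space
begin

text \<open>The coefficient \<open>c\<close> does not depend on \<open>r\<close>, so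
  \<open>Y t - c * Y s\<close> is uncorrelated with the whole past up to \<open>s\<close>, hence
  independent of it. Freezing this residual gives the same function of \<open>Y s\<close> whether
  one conditions on the past or on the present.\<close>

lemma markov_of_regression:
  assumes Y: "\<And>t. t \<in> T \<Longrightarrow> Y t \<in> H"
    and reg: "\<And>s t. s \<in> T \<Longrightarrow> t \<in> T \<Longrightarrow> s \<le> t \<Longrightarrow>
      \<exists>c. \<forall>r\<in>T. r \<le> s \<longrightarrow> cov (Y r) (Y t) = c * cov (Y r) (Y s)"
  shows "markov_process M T Y"
  unfolding markov_process_def
proof (intro ballI impI)
  fix s t and B :: "real set" assume st: "s \<in> T" "t \<in> T" "s \<le> t" and [measurable]: "B \<in> sets borel"
  let ?R = "{r \<in> T. r \<le> s}"
  obtain c where c: "\<And>r. r \<in> ?R \<Longrightarrow> cov (Y r) (Y t) = c * cov (Y r) (Y s)"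
    using reg[OF st] by auto
  define V where "V = (\<lambda>\<omega>. Y t \<omega> - c * Y s \<omega>)"
  have V: "V \<in> H" unfolding V_def using Y st by (intro diff_H scale_H)
  \<comment> \<open>\<open>indep_of_uncorrelated\<close> speaks of families, so the single variable
    \<open>V\<close> enters as a family over the one-point set \<open>{()}\<close>.\<close>
  have "indep_pair M (\<Pi>\<^sub>M r\<in>?R. borel) (\<lambda>\<omega>. \<lambda>r\<in>?R. Y r \<omega>) (\<Pi>\<^sub>M i\<in>{()}. borel) (\<lambda>\<omega>. \<lambda>i\<in>{()}. V \<omega>)"
    using Y st V c by (intro indep_of_uncorrelated) (auto simp: V_def cov_diff_right cov_scale_right scale_H)
  from indep_pair_compose[OF this measurable_ident measurable_component_singleton[of "()"]]
  have 1: "indep_pair M (\<Pi>\<^sub>M r\<in>?R. borel) (\<lambda>\<omega>. \<lambda>r\<in>?R. Y r \<omega>) borel V" by simp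
  have comp: "(\<lambda>f. f s) \<in> (\<Pi>\<^sub>M r\<in>?R. borel) \<rightarrow>\<^sub>M borel" using st by (intro measurable_component_singleton) auto
  from indep_pair_compose[OF 1 this measurable_ident] st
  have 2: "indep_pair M borel (Y s) borel V" by simp
  have "AE \<omega> in M. real_cond_exp M (past_algebra M T Y s) (\<lambda>\<omega>. indicator B (c * (\<lambda>r\<in>?R. Y r \<omega>) s + V \<omega>)) \<omega> =
    (LINT v|distr M borel V. indicator B (c * (\<lambda>r\<in>?R. Y r \<omega>) s + v))"
    unfolding past_algebra_def
    by (intro real_cond_exp_add_indep[OF 1, where g = "\<lambda>f. c * f s"] borel_measurable_times comp) auto
  moreover have "AE \<omega> in M. real_cond_exp M (vimage_algebra (space M) (Y s) borel) (\<lambda>\<omega>. indicator B (c * Y s \<omega> + V \<omega>)) \<omega> =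
    (LINT v|distr M borel V. indicator B (c * Y s \<omega> + v))"
    by (intro real_cond_exp_add_indep[OF 2]) auto
  ultimately show "AE \<omega> in M. real_cond_exp M (past_algebra M T Y s) (\<lambda>\<omega>'. indicator B (Y t \<omega>')) \<omega> =
        real_cond_exp M (vimage_algebra (space M) (Y s) borel) (\<lambda>\<omega>'. indicator B (Y t \<omega>')) \<omega>"
  proof eventually_elim
    case (elim \<omega>)
    then show ?case using st by (simp add: V_def)
  qed
qed

text \<open>For \<open>h \<le> l\<close> the increments after \<open>s\<close> have covariance
  \<open>h * (\<theta> - \<tau> * l)\<close>, free of \<open>s\<close>; the choice
  \<open>s = 0\<close> gives the same value. In a Gaussian space covariances determine the joint
  law.\<close>

lemma stationary_of_cov:
  assumes Y: "\<And>t. t \<in> time_dom \<Delta> \<Longrightarrow> Y t \<in> H" and "0 < \<Delta>"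
    and cov_Y: "\<And>s t. s \<in> time_dom \<Delta> \<Longrightarrow> t \<in> time_dom \<Delta> \<Longrightarrow> s \<le> t \<Longrightarrow> cov (Y s) (Y t) = s * (\<theta> - \<tau> * t)"
  shows "stationary_increments M \<Delta> Y"
  unfolding stationary_increments_def
proof (intro ballI allI impI)
  fix s I assume s: "s \<in> time_dom \<Delta>" and I: "finite I \<and> (\<forall>h\<in>I. 0 \<le> h \<and> s + h \<in> time_dom \<Delta>)"
  have s0: "0 \<le> s" and T0: "0 \<in> time_dom \<Delta>" using s \<open>0 < \<Delta>\<close> by (auto simp: time_dom_def simp flip: zero_ereal_def)
  have h: "h \<in> time_dom \<Delta>" "0 \<le> h" "s + h \<in> time_dom \<Delta>" if "h \<in> I" for h
  proof -
    show "0 \<le> h" "s + h \<in> time_dom \<Delta>" using that I by auto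
    have "ereal h \<le> ereal (s + h)" using s0 by simp
    also have "\<dots> < \<Delta>" using \<open>s + h \<in> time_dom \<Delta>\<close> by (simp add: time_dom_def)
    finally show "h \<in> time_dom \<Delta>" using \<open>0 \<le> h\<close> by (simp add: time_dom_def)
  qed
  define U where "U = (\<lambda>h \<omega>. Y (s + h) \<omega> - Y s \<omega>)"
  define W where "W = (\<lambda>h \<omega>. Y h \<omega> - Y 0 \<omega>)"
  have U: "U h \<in> H" and W: "W h \<in> H" if "h \<in> I" for h
    unfolding U_def W_def using Y s T0 h[OF that] by (auto intro!: diff_H)
  \<comment> \<open>\<open>cov_Y\<close> is available for ordered times only; symmetry removes the
    restriction \<open>h \<le> l\<close> in \<open>UW\<close>.\<close>
  have le: "cov (U h) (U l) = cov (W h) (W l)" if "h \<in> I" "l \<in> I" "h \<le> l" for h l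
  proof -
    note hl = h[OF \<open>h \<in> I\<close>] h[OF \<open>l \<in> I\<close>]
    have "cov (U h) (U l) = cov (Y (s + h)) (Y (s + l)) - cov (Y (s + h)) (Y s) - (cov (Y s) (Y (s + l)) - cov (Y s) (Y s))"
      unfolding U_def using Y s hl by (simp add: cov_diff_left cov_diff_right diff_H)
    also have "cov (Y (s + h)) (Y s) = cov (Y s) (Y (s + h))" by (rule cov_commute)
    finally have "cov (U h) (U l) = (s + h) * (\<theta> - \<tau> * (s + l)) - s * (\<theta> - \<tau> * (s + h))
        - (s * (\<theta> - \<tau> * (s + l)) - s * (\<theta> - \<tau> * s))"
      using cov_Y s hl s0 \<open>h \<le> l\<close> by simp
    then have "cov (U h) (U l) = h * (\<theta> - \<tau> * l)" by (simp add: algebra_simps)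
    moreover have "cov (W h) (W l) = cov (Y h) (Y l) - cov (Y h) (Y 0) - (cov (Y 0) (Y l) - cov (Y 0) (Y 0))"
      unfolding W_def using Y T0 hl by (simp add: cov_diff_left cov_diff_right diff_H)
    moreover have "cov (Y h) (Y 0) = cov (Y 0) (Y h)" by (rule cov_commute)
    ultimately show ?thesis
      using cov_Y T0 hl \<open>h \<le> l\<close> by simp
  qed
  have UW: "cov (U h) (U l) = cov (W h) (W l)" if "h \<in> I" "l \<in> I" for h l
    using le[OF that] le[OF that(2,1)] cov_commute[of "U h" "U l"] cov_commute[of "W h" "W l"] by linarith
  have "distr M (\<Pi>\<^sub>M h\<in>I. borel) (\<lambda>\<omega>. \<lambda>h\<in>I. U h \<omega>) = distr M (\<Pi>\<^sub>M h\<in>I. borel) (\<lambda>\<omega>. \<lambda>h\<in>I. W h \<omega>)"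
  proof (rule distr_PiM_eq_of_cis_eq[OF prob_space_axioms prob_space_axioms])
    fix J a assume "finite J" "J \<subseteq> I"
    then have UJ: "\<And>h. h \<in> J \<Longrightarrow> U h \<in> H" "\<And>h. h \<in> J \<Longrightarrow> W h \<in> H" using U W by auto
    have "cov (\<lambda>\<omega>. \<Sum>h\<in>J. a h * U h \<omega>) (\<lambda>\<omega>. \<Sum>h\<in>J. a h * U h \<omega>) =
        cov (\<lambda>\<omega>. \<Sum>h\<in>J. a h * W h \<omega>) (\<lambda>\<omega>. \<Sum>h\<in>J. a h * W h \<omega>)"
      using \<open>J \<subseteq> I\<close> UW by (simp add: cov_linear_combination UJ subset_eq)
    then show "(LINT \<omega>|M. cis (\<Sum>h\<in>J. a h * U h \<omega>)) = (LINT \<omega>|M. cis (\<Sum>h\<in>J. a h * W h \<omega>))"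
      using UJ by (simp add: cis_cov sum_H scale_H)
  qed (auto intro: measurable_H U W)
  then show "distr M (\<Pi>\<^sub>M h\<in>I. borel) (\<lambda>\<omega>. \<lambda>h\<in>I. Y (s + h) \<omega> - Y s \<omega>) =
        distr M (\<Pi>\<^sub>M h\<in>I. borel) (\<lambda>\<omega>. \<lambda>h\<in>I. Y h \<omega> - Y 0 \<omega>)"
    by (simp add: U_def W_def)
qed

lemma gmsi_of_bridge_cov:
  assumes Y: "\<And>t. t \<in> {0..<w} \<Longrightarrow> Y t \<in> H" and "0 < w" "0 < \<theta>"
    and cov_Y: "\<And>s t. s \<in> {0..<w} \<Longrightarrow> t \<in> {0..<w} \<Longrightarrow> s \<le> t \<Longrightarrow> cov (Y s) (Y t) = s * (\<theta> - \<theta> / w * t)"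
    and cont: "\<And>\<omega>. \<omega> \<in> space M \<Longrightarrow> continuous_on {0..<w} (\<lambda>t. Y t \<omega>)"
  shows "gmsi_process M (ereal w) \<theta> (\<theta> / w) Y"
  unfolding gmsi_process_def time_dom_real
proof (intro conjI ballI impI)
  show "0 < ereal w" "0 < \<theta>" "ereal (\<theta> / w) \<le> ereal \<theta> / ereal w" "prob_space M"
    using assms prob_space_axioms by auto
  show "continuous_on {0..<w} (\<lambda>t. Y t \<omega>)" if "\<omega> \<in> space M" for \<omega> using cont that .
  show "gaussian_process M {0..<w} Y"
    unfolding gaussian_process_def using Y by (auto intro!: gaussian_rv_H sum_H scale_H)
  show "expectation (Y t) = 0" if "t \<in> {0..<w}" for t using Y that by (intro expectation_H)
  show "markov_process M {0..<w} Y"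
  proof (rule markov_of_regression)
    fix s t assume st: "s \<in> {0..<w}" "t \<in> {0..<w}" "s \<le> t"
    \<comment> \<open>The covariance equals \<open>\<theta> * r * (w - t) / w\<close>, a product of
      a function of \<open>r\<close> and one of \<open>t\<close>, so the quotient for
      \<open>t\<close> and \<open>s\<close> does not involve \<open>r\<close>. Its denominator is
      nonzero because \<open>s < w\<close>.\<close>
    have "cov (Y r) (Y t) = (w - t) / (w - s) * cov (Y r) (Y s)" if "r \<in> {0..<w}" "r \<le> s" for r
    proof -
      have "\<theta> - \<theta> / w * t = (w - t) / (w - s) * (\<theta> - \<theta> / w * s)"
        using st \<open>0 < w\<close> by (simp add: field_simps)
      then show ?thesis using cov_Y[of r s] cov_Y[of r t] that st by simp
    qed
    then show "\<exists>c. \<forall>r\<in>{0..<w}. r \<le> s \<longrightarrow> cov (Y r) (Y t) = c * cov (Y r) (Y s)" by blast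
  qed (rule Y)
  show "AE \<omega> in M. Y 0 \<omega> = 0"
    using cov_Y[of 0 0] \<open>0 < w\<close> by (intro AE_zero_H Y) auto
  show "stationary_increments M (ereal w) Y"
    using assms by (intro stationary_of_cov[where \<theta> = \<theta> and \<tau> = "\<theta> / w"]) (auto simp: time_dom_real)
  show "expectation (\<lambda>\<omega>. Y s \<omega> * Y t \<omega>) = s * (\<theta> - \<theta> / w * t)" if "s \<in> {0..<w}" "t \<in> {0..<w}" "s \<le> t" for s t
    using cov_Y[OF that] by (simp add: cov_def)
qed

end

subsection \<open>Conditional path laws\<close>

text \<open>A nondegenerate normal density is positive everywhere, so an interval without mass would
  be Lebesgue null. In the degenerate case all mass sits at 0, and then the hypothesis forces
  \<open>x = 0\<close>.\<close>

lemma (in gaussian_space) prob_near_pos: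
  assumes Y: "Y \<in> H" and x: "cov Y Y = 0 \<Longrightarrow> x = 0" and "0 < \<delta>"
  shows "0 < prob {\<omega> \<in> space M. \<bar>Y \<omega> - x\<bar> < \<delta>}"
proof (cases "cov Y Y = 0")
  case True
  have [measurable]: "Y \<in> borel_measurable M" using Y by (rule measurable_H)
  have "AE \<omega> in M. \<bar>Y \<omega> - x\<bar> < \<delta>" using AE_zero_H[OF Y True] x[OF True] \<open>0 < \<delta>\<close> by auto
  then have "prob {\<omega> \<in> space M. \<bar>Y \<omega> - x\<bar> < \<delta>} = 1" by (intro prob_eq_1[THEN iffD2]) auto
  then show ?thesis by simp
next
  case False
  define \<sigma> where "\<sigma> = sqrt (cov Y Y)"
  have "0 < cov Y Y" using False cov_nonneg[of Y] by linarith
  then have D: "distributed M lborel Y (normal_density 0 \<sigma>)" and "0 < \<sigma>"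
    using normal_H[OF Y] by (auto simp: \<sigma>_def)
  let ?I = "{x - \<delta><..<x + \<delta>}"
  have "emeasure M (Y -` ?I \<inter> space M) = (\<integral>\<^sup>+y. ennreal (normal_density 0 \<sigma> y) * indicator ?I y \<partial>lborel)"
    by (intro distributed_emeasure[OF D]) auto
  moreover have "\<dots> \<noteq> 0"
  proof
    assume "(\<integral>\<^sup>+y. ennreal (normal_density 0 \<sigma> y) * indicator ?I y \<partial>lborel) = 0"
    then have "AE y in lborel. ennreal (normal_density 0 \<sigma> y) * indicator ?I y = 0"
      by (subst (asm) nn_integral_0_iff_AE) auto
    then have "AE y in lborel. y \<notin> ?I"
    proof eventually_elim
      case (elim y)
      then show ?case using normal_density_pos[OF \<open>0 < \<sigma>\<close>, of 0 y] by (auto split: split_indicator_asm)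
    qed
    then have "emeasure lborel ?I = 0" by (subst (asm) AE_iff_measurable[where N = ?I]) auto
    then show False using \<open>0 < \<delta>\<close> by (simp add: ennreal_eq_0_iff)
  qed
  moreover have "Y -` ?I \<inter> space M = {\<omega> \<in> space M. \<bar>Y \<omega> - x\<bar> < \<delta>}" by (auto simp: abs_less_iff)
  ultimately have "emeasure M {\<omega> \<in> space M. \<bar>Y \<omega> - x\<bar> < \<delta>} \<noteq> 0" by simp
  then show ?thesis by (simp add: emeasure_eq_measure zero_less_measure_iff)
qed

lemma measurable_vec_Pair:
  fixes f :: "'b \<Rightarrow> 'n::finite \<Rightarrow> real"
  assumes f: "\<And>i. (\<lambda>x. f x i) \<in> borel_measurable N" and g: "g \<in> borel_measurable N"
  shows "(\<lambda>x. ((\<chi> i. f x i), g x :: real)) \<in> borel_measurable N"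
proof -
  have "(\<lambda>x. \<chi> i. f x i) \<in> borel_measurable N"
    by (subst borel_measurable_euclidean_space) (auto simp: Basis_vec_def inner_axis f)
  then show ?thesis using g by (intro borel_measurable_Pair)
qed

lemma space_path_space: "space (path_space T) = {f \<in> extensional T. continuous_on T f}"
  by (auto simp: path_space_def space_restrict_space space_PiM PiE_def)

lemma measurable_path_space:
  assumes "\<And>t. t \<in> T \<Longrightarrow> f t \<in> borel_measurable M"
    and "\<And>\<omega>. \<omega> \<in> space M \<Longrightarrow> continuous_on T (\<lambda>t. f t \<omega>)"
  shows "(\<lambda>\<omega>. \<lambda>t\<in>T. f t \<omega>) \<in> M \<rightarrow>\<^sub>M path_space T"
  unfolding path_space_def
proof (rule measurable_restrict_space2)
  have "continuous_on T (\<lambda>t\<in>T. f t \<omega>)" if "\<omega> \<in> space M" for \<omega>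
    using assms(2)[OF that] by (subst continuous_on_cong[OF refl, where g = "\<lambda>t. f t \<omega>"]) auto
  then show "(\<lambda>\<omega>. \<lambda>t\<in>T. f t \<omega>) \<in> space M \<rightarrow> {f. continuous_on T f}" by auto
qed (intro measurable_restrict assms)

lemma measurable_path_space_component: "t \<in> T \<Longrightarrow> (\<lambda>f. f t) \<in> borel_measurable (path_space T)"
  unfolding path_space_def by (intro measurable_restrict_space1 measurable_component_singleton)

lemma measurable_path_space_combination:
  "J \<subseteq> T \<Longrightarrow> (\<lambda>f. \<Sum>t\<in>J. a t * f t) \<in> borel_measurable (path_space T)"
  by (intro borel_measurable_sum borel_measurable_times measurable_path_space_component) auto

text \<open>Kernels agree almost everywhere for one event at a time. Rational half-lines are
  countably many, so one null set serves them all, and right continuity of the distribution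
  functions covers the rest.\<close>

lemma real_distribution_eqI_Rats:
  assumes "real_distribution \<mu>" "real_distribution \<nu>"
    and eq: "\<And>q. q \<in> \<rat> \<Longrightarrow> cdf \<mu> q = cdf \<nu> q"
  shows "\<mu> = \<nu>"
proof (rule cdf_unique[OF assms(1,2)], rule ext, rule ccontr)
  interpret \<mu>: real_distribution \<mu> by fact
  interpret \<nu>: real_distribution \<nu> by fact
  fix x assume ne: "cdf \<mu> x \<noteq> cdf \<nu> x"
  have "((\<lambda>y. cdf \<mu> y - cdf \<nu> y) \<longlongrightarrow> cdf \<mu> x - cdf \<nu> x) (at_right x)"
    using \<mu>.cdf_is_right_cont[of x] \<nu>.cdf_is_right_cont[of x]
    by (intro tendsto_diff) (simp_all add: continuous_within)
  then have "eventually (\<lambda>y. cdf \<mu> y - cdf \<nu> y \<noteq> 0) (at_right x)"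
    using ne by (intro tendsto_imp_eventually_ne) auto
  then obtain b where "x < b" and b: "\<And>y. x < y \<Longrightarrow> y < b \<Longrightarrow> cdf \<mu> y \<noteq> cdf \<nu> y"
    by (auto simp: eventually_at_right_field)
  obtain q where "q \<in> \<rat>" "x < q" "q < b" using Rats_dense_in_real[OF \<open>x < b\<close>] by auto
  then show False using b eq by auto
qed

text \<open>The conclusion concerns one linear combination at a time because
  \<open>conditional_path_law\<close> grants weak continuity for exactly these laws.
  \<open>supp\<close> says that \<open>c\<close> lies in the support of the law of
  \<open>C\<close>.\<close>

lemma conditional_path_law_unique:
  fixes C :: "'a \<Rightarrow> 'c::{metric_space, second_countable_topology}"
  assumes "prob_space M" and C[measurable]: "C \<in> borel_measurable M"
    and \<kappa>: "conditional_path_law M T C Y \<kappa>" and \<kappa>': "conditional_path_law M T C Y \<kappa>'"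
    and supp: "\<And>\<epsilon>. 0 < \<epsilon> \<Longrightarrow> 0 < measure M {\<omega> \<in> space M. dist (C \<omega>) c < \<epsilon>}"
    and J: "finite J" "J \<subseteq> T"
  shows "distr (\<kappa> c) borel (\<lambda>f. \<Sum>t\<in>J. a t * f t) = distr (\<kappa>' c) borel (\<lambda>f. \<Sum>t\<in>J. a t * f t)"
proof -
  interpret prob_space M by fact
  let ?S = "\<lambda>f. \<Sum>t\<in>J. a t * f t :: real"
  let ?L = "distr M borel C"
  interpret L: prob_space ?L by (rule prob_space_distr) simp
  have law: "\<kappa> \<in> borel \<rightarrow>\<^sub>M prob_algebra (path_space T)" "\<kappa>' \<in> borel \<rightarrow>\<^sub>M prob_algebra (path_space T)"
    using \<kappa> \<kappa>' by (auto simp: conditional_path_law_def regular_conditional_law_def)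
  then have sub[measurable]: "\<kappa> \<in> borel \<rightarrow>\<^sub>M subprob_algebra (path_space T)" "\<kappa>' \<in> borel \<rightarrow>\<^sub>M subprob_algebra (path_space T)"
    by (auto intro: measurable_prob_algebraD)
  have sets: "sets (\<kappa> d) = sets (path_space T)" "sets (\<kappa>' d) = sets (path_space T)" for d
    using subprob_measurableD(2)[OF sub(1)] subprob_measurableD(2)[OF sub(2)] by auto
  have prob: "prob_space (\<kappa> d)" "prob_space (\<kappa>' d)" for d
    using measurable_space[OF law(1), of d] measurable_space[OF law(2), of d]
    by (auto simp: space_prob_algebra)
  have S: "?S \<in> borel_measurable (\<kappa> d)" "?S \<in> borel_measurable (\<kappa>' d)" for d
    using measurable_path_space_combination[OF J(2), of a] sets by (auto cong: measurable_cong_sets)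
  have rd: "real_distribution (distr (\<kappa> d) borel ?S)" "real_distribution (distr (\<kappa>' d) borel ?S)" for d
    using prob S by (auto intro: prob_space.real_distribution_distr)
  \<comment> \<open>For fixed \<open>B\<close> both functions of \<open>d\<close> are densities,
    with respect to the law of \<open>C\<close>, of the measure that assigns to \<open>A\<close> the
    probability of \<open>C\<close> in \<open>A\<close> and the path in \<open>B\<close>.\<close>
  have "AE d in ?L. emeasure (\<kappa> d) B = emeasure (\<kappa>' d) B" if [measurable]: "B \<in> sets (path_space T)" for B
  proof (rule L.density_unique)
    show [measurable]: "(\<lambda>d. emeasure (\<kappa> d) B) \<in> borel_measurable ?L" "(\<lambda>d. emeasure (\<kappa>' d) B) \<in> borel_measurable ?L"
      using measurable_emeasure_kernel[OF sub(1) that] measurable_emeasure_kernel[OF sub(2) that] by auto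
    show "density ?L (\<lambda>d. emeasure (\<kappa> d) B) = density ?L (\<lambda>d. emeasure (\<kappa>' d) B)"
    proof (rule measure_eqI)
      fix A assume "A \<in> sets (density ?L (\<lambda>d. emeasure (\<kappa> d) B))"
      then have [measurable]: "A \<in> sets borel" by simp
      have "(\<integral>\<^sup>+\<omega>. indicator A (C \<omega>) * emeasure (\<kappa> (C \<omega>)) B \<partial>M) =
          (\<integral>\<^sup>+\<omega>. indicator A (C \<omega>) * emeasure (\<kappa>' (C \<omega>)) B \<partial>M)"
        using \<kappa> \<kappa>' that unfolding conditional_path_law_def regular_conditional_law_def by auto
      then show "emeasure (density ?L (\<lambda>d. emeasure (\<kappa> d) B)) A = emeasure (density ?L (\<lambda>d. emeasure (\<kappa>' d) B)) A"
        by (simp add: emeasure_density nn_integral_distr mult.commute)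
    qed simp
  qed
  then have "AE d in ?L. \<forall>q\<in>\<rat>. emeasure (\<kappa> d) (?S -` {..q} \<inter> space (path_space T)) = emeasure (\<kappa>' d) (?S -` {..q} \<inter> space (path_space T))"
    using measurable_sets[OF measurable_path_space_combination[OF J(2), of a]]
    by (subst AE_ball_countable[OF countable_rat]) auto
  then have AE_eq: "AE d in ?L. distr (\<kappa> d) borel ?S = distr (\<kappa>' d) borel ?S"
  proof eventually_elim
    case (elim d)
    show ?case
    proof (rule real_distribution_eqI_Rats[OF rd])
      fix q :: real assume "q \<in> \<rat>"
      then show "cdf (distr (\<kappa> d) borel ?S) q = cdf (distr (\<kappa>' d) borel ?S) q"
        using elim sets_eq_imp_space_eq[OF sets(1)[of d]] sets_eq_imp_space_eq[OF sets(2)[of d]]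
        by (simp add: cdf_def measure_def emeasure_distr[OF S(1)] emeasure_distr[OF S(2)])
    qed
  qed
  \<comment> \<open>If the laws differed throughout a ball around \<open>c\<close>, that ball would
    be null under the law of \<open>C\<close>, against \<open>supp\<close>.\<close>
  have near: "\<exists>d. dist d c < \<epsilon> \<and> distr (\<kappa> d) borel ?S = distr (\<kappa>' d) borel ?S" if "0 < \<epsilon>" for \<epsilon>
  proof (rule ccontr)
    assume no: "\<not> ?thesis"
    have "AE d in ?L. \<not> dist d c < \<epsilon>" using AE_eq by eventually_elim (use no in auto)
    then have "AE \<omega> in M. \<not> dist (C \<omega>) c < \<epsilon>" by (subst (asm) AE_distr_iff) auto
    then have "prob {\<omega> \<in> space M. dist (C \<omega>) c < \<epsilon>} = 0"
      by (subst (asm) AE_iff_measurable[OF _ refl]) (auto simp: measure_def)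
    then show False using supp[OF that] by simp
  qed
  have "\<forall>n. \<exists>d. dist d c < 1 / real (Suc n) \<and> distr (\<kappa> d) borel ?S = distr (\<kappa>' d) borel ?S"
    by (intro allI near) simp
  from choice[OF this] obtain c' where
    *: "\<forall>n. dist (c' n) c < 1 / real (Suc n) \<and> distr (\<kappa> (c' n)) borel ?S = distr (\<kappa>' (c' n)) borel ?S" ..
  have c': "dist (c' n) c < 1 / real (Suc n)" "distr (\<kappa> (c' n)) borel ?S = distr (\<kappa>' (c' n)) borel ?S" for n
    using *[rule_format, of n] by (rule conjunct1, rule conjunct2)
  have lim: "c' \<longlonglongrightarrow> c"
  proof (rule metric_tendsto_imp_tendsto[of "\<lambda>n. 1 / real (Suc n)" 0])
    show "(\<lambda>n. 1 / real (Suc n)) \<longlonglongrightarrow> 0" using LIMSEQ_inverse_real_of_nat by (simp add: inverse_eq_divide)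
    show "eventually (\<lambda>n. dist (c' n) c \<le> dist (1 / real (Suc n)) 0) sequentially"
      using c'(1) by (intro always_eventually) (auto intro: less_imp_le)
  qed
  have w: "weak_conv_m (\<lambda>n. distr (\<kappa> (c' n)) borel ?S) (distr (\<kappa> c) borel ?S)"
      "weak_conv_m (\<lambda>n. distr (\<kappa>' (c' n)) borel ?S) (distr (\<kappa>' c) borel ?S)"
    using \<kappa> \<kappa>' lim J unfolding conditional_path_law_def by auto
  \<comment> \<open>Along \<open>c'\<close> both kernels give the same laws, so their characteristic
    functions are limits of one and the same sequence.\<close>
  have "char (distr (\<kappa> c) borel ?S) s = char (distr (\<kappa>' c) borel ?S) s" for s
    using levy_continuity1[OF rd(1) rd(1) w(1), of s] levy_continuity1[OF rd(2) rd(2) w(2), of s]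
    unfolding c'(2) by (rule LIMSEQ_unique)
  then show ?thesis by (intro Levy_uniqueness rd) auto
qed

subsection \<open>The bridge of a sum of GMSI processes\<close>

locale gmsi_sum = prob_space M for M :: "'a measure" +
  fixes X :: "'n::finite \<Rightarrow> real \<Rightarrow> 'a \<Rightarrow> real"
    and \<theta> \<tau> k :: "'n \<Rightarrow> real"
    and \<Delta> :: ereal
    and \<rho> u w :: real
  assumes \<theta>_pos: "\<And>i. 0 < \<theta> i"
    and \<Delta>_le: "\<And>i. 0 < \<tau> i \<Longrightarrow> \<Delta> \<le> ereal (\<theta> i / \<tau> i)"
    and gmsi: "\<And>i. gmsi_process M \<Delta> (\<theta> i) (\<tau> i) (X i)"
    and indep: "indep_vars (\<lambda>i. \<Pi>\<^sub>M t\<in>time_dom \<Delta>. borel)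
           (\<lambda>i \<omega>. \<lambda>t\<in>time_dom \<Delta>. X i t \<omega>) UNIV"
    and k_nonzero: "\<exists>i. k i \<noteq> 0"
    and u_nonneg: "0 \<le> u" and w_pos: "0 < w" and w_less: "ereal w < \<Delta> - ereal u"
begin

abbreviation "T \<equiv> time_dom \<Delta>"

lemma time_in: "0 \<le> h \<Longrightarrow> h \<le> w \<Longrightarrow> u + h \<in> T"
proof -
  assume h: "0 \<le> h" "h \<le> w"
  have "ereal (u + w) < \<Delta>" using w_less by (cases \<Delta>) auto
  moreover have "ereal (u + h) \<le> ereal (u + w)" using h by simp
  ultimately have "ereal (u + h) < \<Delta>" by (rule le_less_trans[rotated])
  then show "u + h \<in> T" using u_nonneg h by (simp add: time_dom_def)
qed

lemma u_in: "u \<in> T" using time_in[of 0] w_pos by simp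

text \<open>Strictness comes from the half-open time domain. It makes \<open>X i t\<close>
  nondegenerate for \<open>t > 0\<close> and the denominators in \<open>\<beta>\<close>
  nonzero.\<close>

lemma variance_factor_pos:
  assumes "t \<in> T" shows "0 < \<theta> i - \<tau> i * t"
proof (cases "0 < \<tau> i")
  case True
  have "ereal t < \<Delta>" using assms by (simp add: time_dom_def)
  also note \<Delta>_le[OF True]
  finally have "t < \<theta> i / \<tau> i" by simp
  then show ?thesis using True by (simp add: field_simps)
next
  case False
  then have "\<tau> i * t \<le> 0" using assms by (auto simp: time_dom_def mult_nonpos_nonneg)
  then show ?thesis using \<theta>_pos[of i] by linarith
qed

text \<open>One summand from the span of each \<open>X i\<close>, so that the increments of the sum
  and every single \<open>X i u\<close> lie in a common Gaussian space.\<close>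

definition "H = {\<lambda>\<omega>. \<Sum>i\<in>UNIV. Y i \<omega> | Y. \<forall>i. Y i \<in> process_span T (X i)}"

lemma gaussian_space_span: "gaussian_space M (process_span T (X i))"
  using gmsi[of i] by (intro gaussian_space_process_span) (auto simp: gmsi_process_def)

lemma indep_span:
  assumes "\<And>i. Y i \<in> process_span T (X i)" shows "indep_vars (\<lambda>_. borel) Y UNIV"
proof -
  have "\<forall>i. \<exists>I a. Y i = (\<lambda>\<omega>. \<Sum>t\<in>I. a t * X i t \<omega>) \<and> I \<subseteq> T"
    using assms by (auto simp: process_span_def) metis
  then obtain I a where Y: "\<And>i. Y i = (\<lambda>\<omega>. \<Sum>t\<in>I i. a i t * X i t \<omega>)" and I: "\<And>i. I i \<subseteq> T"
    by metis
  \<comment> \<open>\<open>indep\<close> is about paths restricted to \<open>T\<close>, so the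
    combination is first written as a function of the restricted path.\<close>
  have "indep_vars (\<lambda>_. borel) (\<lambda>i \<omega>. \<Sum>t\<in>I i. a i t * (\<lambda>t\<in>T. X i t \<omega>) t) UNIV"
  proof (rule indep_vars_compose2[OF indep])
    show "(\<lambda>f. \<Sum>t\<in>I i. a i t * f t) \<in> borel_measurable (\<Pi>\<^sub>M t\<in>T. borel)" for i
      using I[of i] by (intro borel_measurable_sum borel_measurable_times measurable_component_singleton) auto
  qed
  moreover have "(\<Sum>t\<in>I i. a i t * (\<lambda>t\<in>T. X i t \<omega>) t) = Y i \<omega>" for i \<omega>
    unfolding Y using I[of i] by (intro sum.cong) auto
  ultimately show ?thesis by simp
qed

sublocale G: gaussian_space M H
  unfolding H_def by (rule gaussian_space_indep_sum[OF gaussian_space_span indep_span])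

lemma span_subset_H:
  assumes "Y \<in> process_span T (X i)" shows "Y \<in> H"
proof -
  interpret S: gaussian_space M "process_span T (X l)" for l by (rule gaussian_space_span)
  let ?Y = "\<lambda>l. if l = i then Y else (\<lambda>_. 0)"
  have "(\<Sum>l\<in>UNIV. ?Y l \<omega>) = (\<Sum>l\<in>UNIV. if l = i then Y \<omega> else 0)" for \<omega>
    by (intro sum.cong) auto
  then have "Y = (\<lambda>\<omega>. \<Sum>l\<in>UNIV. ?Y l \<omega>)" by simp
  moreover have "?Y l \<in> process_span T (X l)" for l using assms S.zero_H[of l] by auto
  ultimately show ?thesis unfolding H_def by (intro CollectI exI[of _ ?Y] conjI allI)
qed

lemma X_in_H: "t \<in> T \<Longrightarrow> X i t \<in> H"
  by (intro span_subset_H[of _ i] process_span_component)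

lemma cov_X: "s \<in> T \<Longrightarrow> t \<in> T \<Longrightarrow> s \<le> t \<Longrightarrow> G.cov (X i s) (X i t) = s * (\<theta> i - \<tau> i * t)"
  using gmsi[of i] by (auto simp: gmsi_process_def G.cov_def)

lemma cov_X_diff: "i \<noteq> j \<Longrightarrow> s \<in> T \<Longrightarrow> t \<in> T \<Longrightarrow> G.cov (X i s) (X j t) = 0"
  unfolding G.cov_def
  by (rule cov_indep_spaces[OF gaussian_space_span _ _ process_span_component process_span_component])
    (auto intro: indep_span)

section \<open>Covariances of the increments and of the bridge\<close>

definition incr :: "'n \<Rightarrow> real \<Rightarrow> 'a \<Rightarrow> real" where "incr i h \<omega> = X i (u + h) \<omega> - X i u \<omega>"

text \<open>The increment of \<open>Z\<close> without its drift, hence centred. The drift part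
  \<open>\<rho> * h\<close> is linear in \<open>h\<close> and is removed by the chord
  anyway.\<close>

definition D :: "real \<Rightarrow> 'a \<Rightarrow> real" where "D h \<omega> = (\<Sum>i\<in>UNIV. k i * incr i h \<omega>)"

definition B :: "real \<Rightarrow> 'a \<Rightarrow> real" where "B h \<omega> = D h \<omega> - h / w * D w \<omega>"

text \<open>The covariance parameters of the weighted sum: independence removes the mixed terms and
  leaves the squares of the weights.\<close>

abbreviation "\<Theta> \<equiv> \<Sum>i\<in>UNIV. (k i)\<^sup>2 * \<theta> i"
abbreviation "\<T> \<equiv> \<Sum>i\<in>UNIV. (k i)\<^sup>2 * \<tau> i"

lemma incr_in_H: "0 \<le> h \<Longrightarrow> h \<le> w \<Longrightarrow> incr i h \<in> H"
  unfolding incr_def[abs_def] by (intro G.diff_H X_in_H time_in u_in)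

lemma D_in_H: "0 \<le> h \<Longrightarrow> h \<le> w \<Longrightarrow> D h \<in> H"
  unfolding D_def[abs_def] by (intro G.sum_H G.scale_H incr_in_H)

lemma B_in_H: "0 \<le> h \<Longrightarrow> h \<le> w \<Longrightarrow> B h \<in> H"
  using w_pos unfolding B_def[abs_def] by (intro G.diff_H G.scale_H D_in_H) auto

text \<open>Since \<open>u\<close> is the earlier time, the later one enters the covariance only
  through \<open>- \<tau> j * u * (u + h)\<close>. Subtracting its value at \<open>h = 0\<close>
  leaves a term linear in \<open>h\<close>.\<close>

lemma cov_incr_X:
  assumes "0 \<le> h" "h \<le> w"
  shows "G.cov (incr i h) (X j u) = (if i = j then - \<tau> j * u * h else 0)"
proof -
  have "G.cov (incr i h) (X j u) = G.cov (X j u) (X i (u + h)) - G.cov (X j u) (X i u)"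
    using assms by (subst G.cov_commute) (simp add: incr_def[abs_def] G.cov_diff_right X_in_H time_in u_in)
  then show ?thesis
    using assms cov_X[of u "u + h" j] cov_X[of u u j] cov_X_diff[of j i u "u + h"] cov_X_diff[of j i u u] time_in u_in
    by (cases "i = j") (simp_all add: algebra_simps)
qed

text \<open>All terms containing \<open>u\<close> cancel, as stationary increments demand.\<close>

lemma cov_incr:
  assumes "0 \<le> h" "h \<le> l" "l \<le> w"
  shows "G.cov (incr i h) (incr j l) = (if i = j then h * (\<theta> j - \<tau> j * l) else 0)"
proof -
  have in_T: "u + h \<in> T" "u + l \<in> T" "u \<in> T" using assms time_in u_in by auto
  have "G.cov (incr i h) (incr j l) = G.cov (incr i h) (X j (u + l)) - G.cov (incr i h) (X j u)"
    using assms by (simp add: incr_def[of j, abs_def] G.cov_diff_right incr_in_H X_in_H in_T)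
  also have "G.cov (incr i h) (X j (u + l)) = G.cov (X i (u + h)) (X j (u + l)) - G.cov (X i u) (X j (u + l))"
    by (simp add: incr_def[abs_def] G.cov_diff_left X_in_H in_T)
  finally show ?thesis
    using assms cov_incr_X[of h i j] cov_X[of "u + h" "u + l" j] cov_X[of u "u + l" j]
      cov_X_diff[of i j "u + h" "u + l"] cov_X_diff[of i j u "u + l"] in_T
    by (auto simp: algebra_simps)
qed

lemma cov_D_X: "0 \<le> h \<Longrightarrow> h \<le> w \<Longrightarrow> G.cov (D h) (X j u) = - (k j * \<tau> j * u * h)"
  by (simp add: D_def[abs_def] G.cov_sum_left G.scale_H incr_in_H X_in_H u_in G.cov_scale_left cov_incr_X
      if_distrib[of "\<lambda>x. _ * x"] cong: if_cong)

lemma cov_D: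
  assumes "0 \<le> h" "h \<le> l" "l \<le> w"
  shows "G.cov (D h) (D l) = h * (\<Theta> - \<T> * l)"
proof -
  have hl: "h \<le> w" "0 \<le> l" using assms by auto
  have "G.cov (D h) (D l) = (\<Sum>i\<in>UNIV. \<Sum>j\<in>UNIV. k i * (k j * G.cov (incr i h) (incr j l)))"
    unfolding D_def[abs_def] using assms hl
    by (simp add: G.cov_sum_left G.cov_sum_right G.sum_H G.scale_H incr_in_H G.cov_scale_left G.cov_scale_right
       sum_distrib_left)
  also have "\<dots> = (\<Sum>i\<in>UNIV. \<Sum>j\<in>UNIV. if i = j then (k i)\<^sup>2 * (h * (\<theta> i - \<tau> i * l)) else 0)"
    using assms by (intro sum.cong refl) (simp add: cov_incr power2_eq_square)
  also have "\<dots> = h * (\<Theta> - \<T> * l)"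
    by (simp add: sum_distrib_left sum_distrib_right sum_subtractf algebra_simps)
  finally show ?thesis .
qed

lemma cov_B_left:
  "0 \<le> h \<Longrightarrow> h \<le> w \<Longrightarrow> Y \<in> H \<Longrightarrow> G.cov (B h) Y = G.cov (D h) Y - h / w * G.cov (D w) Y"
  unfolding B_def[abs_def]
  by (subst G.cov_diff_left) (auto intro!: G.scale_H D_in_H simp: G.cov_scale_left simp del: times_divide_eq_left)

lemma cov_B_X: "0 \<le> h \<Longrightarrow> h \<le> w \<Longrightarrow> G.cov (B h) (X j u) = 0"
  using w_pos by (simp add: cov_B_left X_in_H u_in cov_D_X)

lemma cov_B_D: "0 \<le> h \<Longrightarrow> h \<le> w \<Longrightarrow> G.cov (B h) (D w) = 0"
  using w_pos by (simp add: cov_B_left D_in_H cov_D)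

text \<open>Only the \<open>D l\<close> part of \<open>B l\<close> contributes, because
  \<open>B h\<close> is uncorrelated with \<open>D w\<close>. In what remains the chord compensates
  \<open>\<T> * h * l\<close> exactly, and the second parameter \<open>\<Theta> / w\<close> is the
  coefficient that the chord brings in.\<close>

lemma cov_B:
  assumes "0 \<le> h" "h \<le> l" "l \<le> w"
  shows "G.cov (B h) (B l) = h * (\<Theta> - \<Theta> / w * l)"
proof -
  have hl: "h \<le> w" "0 \<le> l" using assms by auto
  have "G.cov (B h) (B l) = G.cov (B l) (B h)" by (rule G.cov_commute)
  also have "\<dots> = G.cov (D l) (B h) - l / w * G.cov (D w) (B h)"
    using assms hl by (intro cov_B_left B_in_H)
  also have "G.cov (D w) (B h) = 0"
    using cov_B_D[OF assms(1) hl(1)] by (subst G.cov_commute)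
  also have "G.cov (D l) (B h) = G.cov (B h) (D l)" by (rule G.cov_commute)
  also have "\<dots> = G.cov (D h) (D l) - h / w * G.cov (D w) (D l)"
    using assms hl by (intro cov_B_left D_in_H)
  also have "G.cov (D w) (D l) = G.cov (D l) (D w)" by (rule G.cov_commute)
  also have "G.cov (D h) (D l) - h / w * G.cov (D l) (D w) - l / w * 0 =
      h * (\<Theta> - \<T> * l) - h / w * (l * (\<Theta> - \<T> * w))"
    using assms hl by (simp add: cov_D)
  also have "\<dots> = h * (\<Theta> - \<Theta> / w * l)"
    using w_pos by (simp add: field_simps)
  finally show ?thesis .
qed

text \<open>
  \<open>V\<close> is the residual of the regression of \<open>D w\<close> on the \<open>X j u\<close>.
\<close>

definition \<beta> :: "'n \<Rightarrow> real" where "\<beta> j = k j * \<tau> j * w / (\<theta> j - \<tau> j * u)"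

definition V :: "'a \<Rightarrow> real" where "V \<omega> = D w \<omega> + (\<Sum>j\<in>UNIV. \<beta> j * X j u \<omega>)"

lemma V_in_H: "V \<in> H"
  using w_pos unfolding V_def[abs_def] by (intro G.add_H G.sum_H G.scale_H D_in_H X_in_H u_in) auto

lemma cov_V_left: "Y \<in> H \<Longrightarrow> G.cov V Y = G.cov (D w) Y + (\<Sum>j\<in>UNIV. \<beta> j * G.cov (X j u) Y)"
  using w_pos unfolding V_def[abs_def]
  by (simp add: G.cov_add_left G.cov_sum_left G.cov_scale_left G.sum_H G.scale_H D_in_H X_in_H u_in)

text \<open>\<open>\<beta> i\<close> is minus the regression coefficient: the covariance
  \<open>- (k i * \<tau> i * u * w)\<close> of \<open>D w\<close> with \<open>X i u\<close> is
  divided by the variance \<open>u * (\<theta> i - \<tau> i * u)\<close>. The factor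
  \<open>u\<close> is already cancelled in \<open>\<beta>\<close>, so the formula also makes sense
  at \<open>u = 0\<close>.\<close>

lemma cov_V_X: "G.cov V (X i u) = 0"
proof -
  have "G.cov V (X i u) = G.cov (D w) (X i u) + (\<Sum>j\<in>UNIV. \<beta> j * G.cov (X j u) (X i u))"
    by (intro cov_V_left X_in_H u_in)
  also have "(\<Sum>j\<in>UNIV. \<beta> j * G.cov (X j u) (X i u)) = (\<Sum>j\<in>UNIV. if j = i then \<beta> i * (u * (\<theta> i - \<tau> i * u)) else 0)"
    using cov_X[OF u_in u_in] cov_X_diff[OF _ u_in u_in] by (intro sum.cong) auto
  also have "\<dots> = k i * \<tau> i * u * w"
    using variance_factor_pos[OF u_in, of i] by (simp add: \<beta>_def)
  finally show ?thesis using w_pos by (simp add: cov_D_X)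
qed

text \<open>As \<open>V\<close> is uncorrelated with each \<open>X j u\<close>, its variance is its
  covariance with \<open>D w\<close>. This becomes a sum of terms with the factor
  \<open>\<theta> i - \<tau> i * (u + w)\<close>, positive because \<open>u + w\<close> is still
  before the horizon; a single nonzero \<open>k l\<close> makes the sum positive.\<close>

lemma cov_V_pos: "0 < G.cov V V"
proof -
  obtain l where l: "k l \<noteq> 0" using k_nonzero by auto
  have X_V: "G.cov (X j u) V = 0" for j
    using cov_V_X by (subst G.cov_commute)
  have "G.cov V V = G.cov (D w) V"
    by (simp add: cov_V_left V_in_H X_V)
  also have "\<dots> = G.cov V (D w)" by (rule G.cov_commute)
  also have "\<dots> = G.cov (D w) (D w) + (\<Sum>j\<in>UNIV. \<beta> j * G.cov (X j u) (D w))"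
    using w_pos by (intro cov_V_left D_in_H) auto
  also have "\<dots> = G.cov (D w) (D w) + (\<Sum>j\<in>UNIV. \<beta> j * G.cov (D w) (X j u))"
    by (subst G.cov_commute[of "X _ u"]) simp
  also have "\<dots> = (\<Sum>i\<in>UNIV. (k i)\<^sup>2 * (w * \<theta> i * (\<theta> i - \<tau> i * (u + w)) / (\<theta> i - \<tau> i * u)))"
  proof -
    have "(k i)\<^sup>2 * (w * \<theta> i * (\<theta> i - \<tau> i * (u + w)) / (\<theta> i - \<tau> i * u)) =
        w * ((k i)\<^sup>2 * \<theta> i - (k i)\<^sup>2 * \<tau> i * w) + \<beta> i * - (k i * \<tau> i * u * w)" for i
      using variance_factor_pos[OF u_in, of i] unfolding \<beta>_def
      by (simp add: field_simps power2_eq_square)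
    then show ?thesis
      using w_pos by (simp add: cov_D cov_D_X sum.distrib sum_subtractf sum_negf
          sum_distrib_left sum_distrib_right right_diff_distrib)
  qed
  also have "\<dots> > 0"
  proof (rule sum_pos2[of _ l])
    have pos: "0 < w * \<theta> i * (\<theta> i - \<tau> i * (u + w)) / (\<theta> i - \<tau> i * u)" for i
      using variance_factor_pos[OF u_in, of i] variance_factor_pos[OF time_in[of w], of i] w_pos \<theta>_pos[of i] by simp
    show "0 < (k l)\<^sup>2 * (w * \<theta> l * (\<theta> l - \<tau> l * (u + w)) / (\<theta> l - \<tau> l * u))"
      using pos[of l] l by (intro mult_pos_pos) auto
    show "0 \<le> (k j)\<^sup>2 * (w * \<theta> j * (\<theta> j - \<tau> j * (u + w)) / (\<theta> j - \<tau> j * u))" for j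
      using less_imp_le[OF pos[of j]] by (intro mult_nonneg_nonneg) auto
  qed auto
  finally show ?thesis .
qed

section \<open>The bridge law as a conditional law\<close>

definition Z :: "real \<Rightarrow> 'a \<Rightarrow> real" where "Z t \<omega> = \<rho> * t + (\<Sum>i\<in>UNIV. k i * X i t \<omega>)"

definition C :: "'a \<Rightarrow> (real ^ 'n) \<times> real" where "C \<omega> = ((\<chi> i. X i u \<omega>), Z (u + w) \<omega> - Z u \<omega>)"

lemma Z_increment: "Z (u + h) \<omega> - Z u \<omega> = \<rho> * h + D h \<omega>"
  by (simp add: Z_def D_def incr_def sum_subtractf algebra_simps)

text \<open>The second component of \<open>C\<close> is \<open>\<rho> * w + D w \<omega>\<close>, so
  the chord through it restores both the drift and the part of \<open>D h\<close> that was
  subtracted in \<open>B h\<close>.\<close>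

lemma Z_increment_bridge: "Z (u + h) \<omega> - Z u \<omega> = B h \<omega> + h / w * snd (C \<omega>)"
  unfolding C_def snd_conv Z_increment B_def using w_pos by (simp add: field_simps)

lemma indep_C_B: "indep_pair M borel C (\<Pi>\<^sub>M h\<in>{0..<w}. borel) (\<lambda>\<omega>. \<lambda>h\<in>{0..<w}. B h \<omega>)"
proof -
  \<comment> \<open>\<open>None\<close> indexes \<open>D w\<close>, and \<open>Some i\<close>
    indexes \<open>X i u\<close>. \<open>C\<close> is a measurable image of this family, the drift
    \<open>\<rho> * w\<close> being added afterwards.\<close>
  let ?P = "\<lambda>s. case s of None \<Rightarrow> D w | Some i \<Rightarrow> X i u"
  have 1: "indep_pair M (\<Pi>\<^sub>M s\<in>UNIV. borel) (\<lambda>\<omega>. \<lambda>s\<in>UNIV. ?P s \<omega>) (\<Pi>\<^sub>M h\<in>{0..<w}. borel) (\<lambda>\<omega>. \<lambda>h\<in>{0..<w}. B h \<omega>)"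
  proof (rule G.indep_of_uncorrelated)
    show "?P s \<in> H" for s using w_pos by (auto split: option.split intro: D_in_H X_in_H u_in)
    show "B h \<in> H" if "h \<in> {0..<w}" for h using that by (intro B_in_H) auto
    show "G.cov (?P s) (B h) = 0" if "h \<in> {0..<w}" for s h
      using that by (subst G.cov_commute) (auto split: option.split simp: cov_B_X cov_B_D)
  qed
  have 2: "(\<lambda>f :: 'n option \<Rightarrow> real. ((\<chi> i. f (Some i)), \<rho> * w + f None)) \<in> borel_measurable (\<Pi>\<^sub>M s\<in>UNIV. borel)"
    by (intro measurable_vec_Pair borel_measurable_add measurable_component_singleton) auto
  from indep_pair_compose[OF 1 2 measurable_ident] show ?thesis
    by (simp add: C_def[abs_def] Z_increment)
qed

lemma measurable_C[measurable]: "C \<in> borel_measurable M"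
  using indep_C_B by (simp add: indep_pair_def)

lemma continuous_B:
  assumes "\<omega> \<in> space M" shows "continuous_on {0..<w} (\<lambda>h. B h \<omega>)"
proof -
  have "continuous_on {0..<w} (\<lambda>h. X i (u + h) \<omega>)" for i
  proof (rule continuous_on_compose2[of T "\<lambda>t. X i t \<omega>"])
    show "continuous_on T (\<lambda>t. X i t \<omega>)" using gmsi[of i] assms by (simp add: gmsi_process_def)
    show "(\<lambda>h. u + h) ` {0..<w} \<subseteq> T" by (intro image_subsetI time_in) auto
  qed (intro continuous_intros)
  then show ?thesis
    unfolding B_def D_def incr_def using w_pos by (intro continuous_intros) auto
qed

text \<open>Only \<open>snd c\<close> occurs: once the total increment is fixed, the values of the
  \<open>X i u\<close> have no further influence on the path.\<close>

definition bridge_law :: "(real ^ 'n) \<times> real \<Rightarrow> (real \<Rightarrow> real) measure" where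
  "bridge_law c = distr M (path_space {0..<w}) (\<lambda>\<omega>. \<lambda>h\<in>{0..<w}. B h \<omega> + h / w * snd c)"

lemma measurable_B: "h \<in> {0..<w} \<Longrightarrow> B h \<in> borel_measurable M"
  by (intro G.measurable_H B_in_H) auto

lemma measurable_bridge:
  "(\<lambda>\<omega>. \<lambda>h\<in>{0..<w}. B h \<omega> + h / w * snd c) \<in> M \<rightarrow>\<^sub>M path_space {0..<w}"
proof (rule measurable_path_space)
  show "(\<lambda>\<omega>. B h \<omega> + h / w * snd c) \<in> borel_measurable M" if "h \<in> {0..<w}" for h
    using measurable_B[OF that] by simp
  show "continuous_on {0..<w} (\<lambda>h. B h \<omega> + h / w * snd c)" if "\<omega> \<in> space M" for \<omega>
    using continuous_B[OF that] w_pos by (intro continuous_intros) auto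
qed

lemma distr_bridge_law:
  assumes "J \<subseteq> {0..<w}"
  shows "distr (bridge_law c) borel (\<lambda>f. \<Sum>t\<in>J. a t * f t) =
    distr M borel (\<lambda>\<omega>. (\<Sum>t\<in>J. a t * B t \<omega>) + (\<Sum>t\<in>J. a t * (t / w)) * snd c)"
proof -
  have "distr (bridge_law c) borel (\<lambda>f. \<Sum>t\<in>J. a t * f t) =
      distr M borel (\<lambda>\<omega>. \<Sum>t\<in>J. a t * (\<lambda>h\<in>{0..<w}. B h \<omega> + h / w * snd c) t)"
    unfolding bridge_law_def using assms
    by (subst distr_distr[OF measurable_path_space_combination measurable_bridge]) (auto simp: comp_def)
  also have "(\<lambda>\<omega>. \<Sum>t\<in>J. a t * (\<lambda>h\<in>{0..<w}. B h \<omega> + h / w * snd c) t) =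
      (\<lambda>\<omega>. (\<Sum>t\<in>J. a t * B t \<omega>) + (\<Sum>t\<in>J. a t * (t / w)) * snd c)"
  proof
    fix \<omega>
    have "(\<Sum>t\<in>J. a t * (\<lambda>h\<in>{0..<w}. B h \<omega> + h / w * snd c) t) = (\<Sum>t\<in>J. a t * (B t \<omega> + t / w * snd c))"
      using assms by (intro sum.cong) auto
    then show "(\<Sum>t\<in>J. a t * (\<lambda>h\<in>{0..<w}. B h \<omega> + h / w * snd c) t) =
        (\<Sum>t\<in>J. a t * B t \<omega>) + (\<Sum>t\<in>J. a t * (t / w)) * snd c"
      by (simp add: distrib_left sum.distrib sum_distrib_right mult.assoc)
  qed
  finally show ?thesis .
qed

lemma kernel_bridge_law: "bridge_law \<in> borel \<rightarrow>\<^sub>M prob_algebra (path_space {0..<w})"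
proof -
  have M: "(\<lambda>_. M) \<in> borel \<rightarrow>\<^sub>M prob_algebra M"
    by (intro measurable_const) (simp add: space_prob_algebra prob_space_axioms)
  have "(\<lambda>(c :: (real ^ 'n) \<times> real, \<omega>). \<lambda>h\<in>{0..<w}. B h \<omega> + h / w * snd c) \<in> borel \<Otimes>\<^sub>M M \<rightarrow>\<^sub>M path_space {0..<w}"
    unfolding split_beta
  proof (rule measurable_path_space)
    show "(\<lambda>x. B h (snd x) + h / w * snd (fst x)) \<in> borel_measurable ((borel :: ((real ^ 'n) \<times> real) measure) \<Otimes>\<^sub>M M)" if "h \<in> {0..<w}" for h
      by (intro borel_measurable_add borel_measurable_times measurable_const
          measurable_compose[OF measurable_snd measurable_B[OF that]]
          measurable_compose[OF measurable_fst borel_measurable_continuous_onI] continuous_intros)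
    show "continuous_on {0..<w} (\<lambda>h. B h (snd x) + h / w * snd (fst x))"
      if "x \<in> space ((borel :: ((real ^ 'n) \<times> real) measure) \<Otimes>\<^sub>M M)" for x
      using continuous_B[of "snd x"] that w_pos by (intro continuous_intros) (auto simp: space_pair_measure)
  qed
  from measurable_distr_prob_space2[OF M this] show ?thesis
    by (simp add: bridge_law_def[abs_def])
qed

text \<open>The defining equation of a regular conditional law is Fubini for the product law of
  \<open>C\<close> and the bridge. Weak continuity is read off characteristic functions.\<close>

lemma bridge_law_conditional:
  "conditional_path_law M {0..<w} C (\<lambda>h \<omega>. Z (u + h) \<omega> - Z u \<omega>) bridge_law"
  unfolding conditional_path_law_def regular_conditional_law_def
proof (intro conjI kernel_bridge_law ballI allI impI)
  fix A :: "((real ^ 'n) \<times> real) set" and S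
  assume A[measurable]: "A \<in> sets borel" and "S \<in> sets (path_space {0..<w})"
  \<comment> \<open>\<open>S\<close> is the trace on continuous paths of a set \<open>S'\<close> of
    the full product space. The shifted bridges are continuous, so \<open>S\<close> may be replaced
    by \<open>S'\<close>, which lives where independence of \<open>C\<close> and the bridge is
    stated.\<close>
  then obtain S' where [measurable]: "S' \<in> sets (\<Pi>\<^sub>M t\<in>{0..<w}. borel)" and S: "S = S' \<inter> {f. continuous_on {0..<w} f}"
    by (auto simp: path_space_def sets_restrict_space)
  let ?R = "\<Pi>\<^sub>M t\<in>{0..<w}. borel :: real measure"
  let ?B = "\<lambda>\<omega>. \<lambda>h\<in>{0..<w}. B h \<omega>"
  define sh where "sh = (\<lambda>(c :: (real ^ 'n) \<times> real, b :: real \<Rightarrow> real). \<lambda>h\<in>{0..<w}. b h + h / w * snd c)"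
  have sh[measurable]: "sh \<in> borel \<Otimes>\<^sub>M ?R \<rightarrow>\<^sub>M ?R"
  proof -
    have "snd \<in> borel_measurable (borel :: ((real ^ 'n) \<times> real) measure)"
      by (intro borel_measurable_continuous_onI continuous_intros)
    then show ?thesis
      unfolding sh_def split_beta
      by (intro measurable_restrict borel_measurable_add borel_measurable_times
          measurable_compose[OF measurable_snd measurable_component_singleton]
          measurable_compose[OF measurable_fst]) auto
  qed
  have mB[measurable]: "?B \<in> M \<rightarrow>\<^sub>M ?R" and ind: "distr M borel C \<Otimes>\<^sub>M distr M ?R ?B = distr M (borel \<Otimes>\<^sub>M ?R) (\<lambda>\<omega>. (C \<omega>, ?B \<omega>))"
    using indep_C_B by (auto simp: indep_pair_def)
  interpret DC: prob_space "distr M borel C" by (rule prob_space_distr) simp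
  interpret DB: prob_space "distr M ?R ?B" by (rule prob_space_distr) simp
  have in_S: "(\<lambda>h\<in>{0..<w}. B h \<omega> + h / w * snd c) \<in> S \<longleftrightarrow> sh (c, ?B \<omega>) \<in> S'" if "\<omega> \<in> space M" for \<omega> c
  proof -
    have "sh (c, ?B \<omega>) = (\<lambda>h\<in>{0..<w}. B h \<omega> + h / w * snd c)"
      by (auto simp: sh_def fun_eq_iff)
    then show ?thesis
      using measurable_space[OF measurable_bridge that, of c] by (simp add: S space_path_space)
  qed
  have bl: "emeasure (bridge_law c) S = (\<integral>\<^sup>+b. indicator S' (sh (c, b)) \<partial>distr M ?R ?B)" for c
  proof -
    have "emeasure (bridge_law c) S = emeasure M {\<omega> \<in> space M. sh (c, ?B \<omega>) \<in> S'}"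
    proof -
      have "(\<lambda>\<omega>. \<lambda>h\<in>{0..<w}. B h \<omega> + h / w * snd c) -` S \<inter> space M = {\<omega> \<in> space M. sh (c, ?B \<omega>) \<in> S'}"
        using in_S by blast
      then show ?thesis
        by (simp only: bridge_law_def emeasure_distr[OF measurable_bridge \<open>S \<in> sets (path_space {0..<w})\<close>])
    qed
    also have "\<dots> = (\<integral>\<^sup>+\<omega>. indicator {\<omega> \<in> space M. sh (c, ?B \<omega>) \<in> S'} \<omega> \<partial>M)"
      by (intro nn_integral_indicator[symmetric]) measurable
    also have "\<dots> = (\<integral>\<^sup>+\<omega>. indicator S' (sh (c, ?B \<omega>)) \<partial>M)"
      by (intro nn_integral_cong) (auto split: split_indicator)
    also have "\<dots> = (\<integral>\<^sup>+b. indicator S' (sh (c, b)) \<partial>distr M ?R ?B)"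
      by (subst nn_integral_distr) measurable
    finally show ?thesis .
  qed
  let ?f = "\<lambda>p. indicator A (fst p) * indicator S' (sh p) :: ennreal"
  have "{\<omega> \<in> space M. C \<omega> \<in> A \<and> (\<lambda>t\<in>{0..<w}. Z (u + t) \<omega> - Z u \<omega>) \<in> S} =
      {\<omega> \<in> space M. C \<omega> \<in> A \<and> sh (C \<omega>, ?B \<omega>) \<in> S'}"
    unfolding Z_increment_bridge using in_S by blast
  then have "emeasure M {\<omega> \<in> space M. C \<omega> \<in> A \<and> (\<lambda>t\<in>{0..<w}. Z (u + t) \<omega> - Z u \<omega>) \<in> S} =
      (\<integral>\<^sup>+\<omega>. indicator {\<omega> \<in> space M. C \<omega> \<in> A \<and> sh (C \<omega>, ?B \<omega>) \<in> S'} \<omega> \<partial>M)"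
    by (simp only:) (intro nn_integral_indicator[symmetric], measurable)
  also have "\<dots> = (\<integral>\<^sup>+\<omega>. ?f (C \<omega>, ?B \<omega>) \<partial>M)"
    by (intro nn_integral_cong) (auto split: split_indicator)
  also have "\<dots> = (\<integral>\<^sup>+p. ?f p \<partial>distr M (borel \<Otimes>\<^sub>M ?R) (\<lambda>\<omega>. (C \<omega>, ?B \<omega>)))"
    by (subst nn_integral_distr) measurable
  also have "\<dots> = (\<integral>\<^sup>+c. \<integral>\<^sup>+b. ?f (c, b) \<partial>distr M ?R ?B \<partial>distr M borel C)"
    unfolding ind[symmetric] by (intro DB.nn_integral_fst[symmetric]) measurable
  also have "\<dots> = (\<integral>\<^sup>+c. indicator A c * emeasure (bridge_law c) S \<partial>distr M borel C)"
    unfolding bl by (intro nn_integral_cong) (simp add: nn_integral_cmult)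
  also have "\<dots> = (\<integral>\<^sup>+\<omega>. indicator A (C \<omega>) * emeasure (bridge_law (C \<omega>)) S \<partial>M)"
  proof -
    have "(\<lambda>c. emeasure (bridge_law c) S) \<in> borel_measurable borel"
      by (rule measurable_emeasure_kernel[OF measurable_prob_algebraD[OF kernel_bridge_law]]) fact
    then show ?thesis by (subst nn_integral_distr) auto
  qed
  finally show "emeasure M {\<omega> \<in> space M. C \<omega> \<in> A \<and> (\<lambda>t\<in>{0..<w}. Z (u + t) \<omega> - Z u \<omega>) \<in> S} =
      (\<integral>\<^sup>+\<omega>. indicator A (C \<omega>) * emeasure (bridge_law (C \<omega>)) S \<partial>M)" .
next
  fix c :: "(real ^ 'n) \<times> real" and c' J and a :: "real \<Rightarrow> real"
  assume *: "c' \<longlonglongrightarrow> c \<and> finite J \<and> J \<subseteq> {0..<w}"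
  then have J: "J \<subseteq> {0..<w}" by simp
  let ?Y = "\<lambda>\<omega>. \<Sum>t\<in>J. a t * B t \<omega>" and ?m = "\<Sum>t\<in>J. a t * (t / w)"
  have [measurable]: "?Y \<in> borel_measurable M"
    using J by (intro borel_measurable_sum borel_measurable_times measurable_B) auto
  \<comment> \<open>A deterministic shift multiplies the characteristic function by a phase, and the
    phase is continuous in the conditioning value.\<close>
  have "char (distr M borel (\<lambda>\<omega>. ?Y \<omega> + ?m * y)) s = cis (s * (?m * y)) * (LINT \<omega>|M. cis (s * ?Y \<omega>))" for s y
    by (subst char_distr_eq_cis) (auto simp: distrib_left cis_mult[symmetric])
  moreover have "(\<lambda>n. cis (s * (?m * snd (c' n))) * (LINT \<omega>|M. cis (s * ?Y \<omega>))) \<longlonglongrightarrow>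
      cis (s * (?m * snd c)) * (LINT \<omega>|M. cis (s * ?Y \<omega>))" for s
    using * by (intro tendsto_intros isCont_tendsto_compose[of _ cis]) (auto intro!: continuous_intros)
  ultimately show "weak_conv_m (\<lambda>n. distr (bridge_law (c' n)) borel (\<lambda>f. \<Sum>t\<in>J. a t * f t))
        (distr (bridge_law c) borel (\<lambda>f. \<Sum>t\<in>J. a t * f t))"
    unfolding distr_bridge_law[OF J] by (intro levy_continuity real_distribution_distr) auto
qed

text \<open>\<open>C\<close> is an affine function of the independent variables \<open>X i u\<close>
  and \<open>V\<close>. A small box in these coordinates is mapped into the given ball, and its
  probability is a product of positive factors.\<close>

lemma C_near_pos:
  assumes "u = 0 \<Longrightarrow> x = 0" and "0 < \<epsilon>"
  shows "0 < prob {\<omega> \<in> space M. dist (C \<omega>) (x, z) < \<epsilon>}"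
proof -
  \<comment> \<open>The value of \<open>V\<close> that corresponds to
    \<open>C \<omega> = (x, z)\<close>, where \<open>D w \<omega> = z - \<rho> * w\<close>.\<close>
  define v where "v = z - \<rho> * w + (\<Sum>j\<in>UNIV. \<beta> j * x $ j)"
  \<comment> \<open>A Lipschitz constant of the affine map: \<open>CARD('n)\<close> bounds the norm
    of the vector component by its coordinates, 1 accounts for \<open>V\<close>, and the sum for the
    regression terms subtracted from \<open>V\<close>.\<close>
  define K where "K = real CARD('n) + 1 + (\<Sum>j\<in>UNIV. \<bar>\<beta> j\<bar>)"
  have "0 < K" unfolding K_def by (intro add_pos_nonneg sum_nonneg) auto
  define \<delta> where "\<delta> = \<epsilon> / K"
  have "0 < \<delta>" using \<open>0 < K\<close> \<open>0 < \<epsilon>\<close> by (simp add: \<delta>_def)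
  let ?E1 = "\<Inter>i\<in>UNIV. X i u -` {y. \<bar>y - x $ i\<bar> < \<delta>} \<inter> space M"
  let ?E2 = "{\<omega> \<in> space M. \<bar>V \<omega> - v\<bar> < \<delta>}"
  have close: "dist (C \<omega>) (x, z) < \<epsilon>" if "\<omega> \<in> ?E1" "\<omega> \<in> ?E2" for \<omega>
  proof -
    have X: "\<bar>X i u \<omega> - x $ i\<bar> < \<delta>" for i using that by auto
    have V: "\<bar>V \<omega> - v\<bar> < \<delta>" using that by auto
    have 1: "dist (C \<omega>) (x, z) \<le> norm ((\<chi> i. X i u \<omega>) - x) + \<bar>Z (u + w) \<omega> - Z u \<omega> - z\<bar>"
      using norm_Pair_le[of "(\<chi> i. X i u \<omega>) - x" "Z (u + w) \<omega> - Z u \<omega> - z"] by (simp add: C_def dist_norm)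
    have 2: "norm ((\<chi> i. X i u \<omega>) - x) \<le> (\<Sum>i\<in>UNIV. \<bar>X i u \<omega> - x $ i\<bar>)"
      using norm_le_l1_cart[of "(\<chi> i. X i u \<omega>) - x"] by simp
    have 3: "(\<Sum>i\<in>UNIV. \<bar>X i u \<omega> - x $ i\<bar>) \<le> real CARD('n) * \<delta>"
      using X by (intro sum_bounded_above) (auto intro: less_imp_le)
    have "Z (u + w) \<omega> - Z u \<omega> - z = (V \<omega> - v) - (\<Sum>j\<in>UNIV. \<beta> j * (X j u \<omega> - x $ j))"
      by (simp add: Z_increment V_def v_def right_diff_distrib sum_subtractf)
    then have 4: "\<bar>Z (u + w) \<omega> - Z u \<omega> - z\<bar> \<le> \<bar>V \<omega> - v\<bar> + (\<Sum>j\<in>UNIV. \<bar>\<beta> j * (X j u \<omega> - x $ j)\<bar>)"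
      using sum_abs[of "\<lambda>j. \<beta> j * (X j u \<omega> - x $ j)" UNIV] by linarith
    have 5: "(\<Sum>j\<in>UNIV. \<bar>\<beta> j * (X j u \<omega> - x $ j)\<bar>) \<le> (\<Sum>j\<in>UNIV. \<bar>\<beta> j\<bar> * \<delta>)"
      using X[THEN less_imp_le] by (intro sum_mono) (simp add: abs_mult mult_left_mono)
    have "dist (C \<omega>) (x, z) < real CARD('n) * \<delta> + (\<delta> + (\<Sum>j\<in>UNIV. \<bar>\<beta> j\<bar> * \<delta>))"
      using 1 2 3 4 5 V by linarith
    also have "\<dots> = K * \<delta>" by (simp add: K_def algebra_simps sum_distrib_left)
    also have "\<dots> = \<epsilon>" using \<open>0 < K\<close> by (simp add: \<delta>_def)
    finally show ?thesis .
  qed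
  have X_pos: "0 < prob (X i u -` {y. \<bar>y - x $ i\<bar> < \<delta>} \<inter> space M)" for i
  proof -
    \<comment> \<open>The variance \<open>u * (\<theta> i - \<tau> i * u)\<close> has a positive
      second factor, so it vanishes only at \<open>u = 0\<close>, where \<open>x = 0\<close> is
      assumed.\<close>
    have "x $ i = 0" if "G.cov (X i u) (X i u) = 0"
      using that cov_X[OF u_in u_in, of i] variance_factor_pos[OF u_in, of i] assms(1) by auto
    from G.prob_near_pos[OF X_in_H[OF u_in, of i] this \<open>0 < \<delta>\<close>]
    show ?thesis by (simp add: vimage_def Int_def conj_commute)
  qed
  have indep_X: "indep_vars (\<lambda>_. borel) (\<lambda>i. X i u) UNIV"
    using u_in by (intro indep_span process_span_component)
  have m: "{y. \<bar>y - r\<bar> < \<delta>} \<in> sets borel" for r :: real by measurable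
  have "prob ?E1 = (\<Prod>i\<in>UNIV. prob (X i u -` {y. \<bar>y - x $ i\<bar> < \<delta>} \<inter> space M))"
    by (rule indep_varsD_finite[OF indep_X]) (auto intro: m)
  then have E1: "0 < prob ?E1" using X_pos by (simp add: prod_pos)
  have E2: "0 < prob ?E2"
    using cov_V_pos \<open>0 < \<delta>\<close> by (intro G.prob_near_pos V_in_H) auto
  let ?P = "\<Pi>\<^sub>M i\<in>(UNIV :: 'n set). borel :: real measure" and ?X = "\<lambda>\<omega>. \<lambda>i\<in>UNIV. X i u \<omega>"
  \<comment> \<open>Independence among the \<open>X i u\<close> is assumed; that of \<open>V\<close>
    from the whole vector holds because \<open>V\<close> is the regression residual.\<close>
  have "indep_pair M ?P ?X (\<Pi>\<^sub>M i\<in>{()}. borel) (\<lambda>\<omega>. \<lambda>i\<in>{()}. V \<omega>)"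
    by (intro G.indep_of_uncorrelated X_in_H u_in V_in_H) (subst G.cov_commute, rule cov_V_X)
  from indep_pair_compose[OF this measurable_ident measurable_component_singleton[of "()"]]
  have mX: "?X \<in> M \<rightarrow>\<^sub>M ?P" and mV: "V \<in> borel_measurable M"
    and pr: "distr M ?P ?X \<Otimes>\<^sub>M distr M borel V = distr M (?P \<Otimes>\<^sub>M borel) (\<lambda>\<omega>. (?X \<omega>, V \<omega>))"
    by (simp_all add: indep_pair_def)
  interpret DV: prob_space "distr M borel V" using mV by (rule prob_space_distr)
  let ?Q1 = "\<Pi>\<^sub>E i\<in>UNIV. {y. \<bar>y - x $ i\<bar> < \<delta>}" and ?Q2 = "{y. \<bar>y - v\<bar> < \<delta>}"
  have Q1: "?Q1 \<in> sets ?P" by (intro sets_PiM_I_finite m) auto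
  have "emeasure (distr M (?P \<Otimes>\<^sub>M borel) (\<lambda>\<omega>. (?X \<omega>, V \<omega>))) (?Q1 \<times> ?Q2) = emeasure (distr M ?P ?X) ?Q1 * emeasure (distr M borel V) ?Q2"
    unfolding pr[symmetric] using Q1 m by (intro DV.emeasure_pair_measure_Times) auto
  moreover have "emeasure (distr M (?P \<Otimes>\<^sub>M borel) (\<lambda>\<omega>. (?X \<omega>, V \<omega>))) (?Q1 \<times> ?Q2) = emeasure M (?E1 \<inter> ?E2)"
    using mX mV Q1 m by (subst emeasure_distr) (auto intro!: arg_cong[where f = "emeasure M"])
  moreover have "emeasure (distr M ?P ?X) ?Q1 = emeasure M ?E1"
    using mX Q1 by (subst emeasure_distr) (auto intro!: arg_cong[where f = "emeasure M"])
  moreover have "emeasure (distr M borel V) ?Q2 = emeasure M ?E2"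
    using mV m by (subst emeasure_distr) (auto intro!: arg_cong[where f = "emeasure M"])
  ultimately have "emeasure M (?E1 \<inter> ?E2) = emeasure M ?E1 * emeasure M ?E2" by simp
  then have "prob (?E1 \<inter> ?E2) = prob ?E1 * prob ?E2"
    by (simp add: measure_def enn2real_mult)
  with E1 E2 have "0 < prob (?E1 \<inter> ?E2)" by simp
  also have "\<dots> \<le> prob {\<omega> \<in> space M. dist (C \<omega>) (x, z) < \<epsilon>}"
    using close by (intro finite_measure_mono) auto
  finally show ?thesis .
qed

lemma \<Theta>_pos: "0 < \<Theta>"
proof -
  obtain l where l: "k l \<noteq> 0" using k_nonzero by auto
  show ?thesis
    using l \<theta>_pos by (intro sum_pos2[of _ l]) (auto intro!: mult_nonneg_nonneg less_imp_le[OF \<theta>_pos])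
qed

text \<open>The law of each linear combination under \<open>\<kappa> (x, z)\<close> is that of the
  same combination of the bridge, shifted by a constant which the subtracted chord removes. The
  coordinates thus span a Gaussian space with the covariances of \<open>B\<close>, and the paths are
  continuous because \<open>\<kappa> (x, z)\<close> lives on the path space.\<close>

lemma gmsi_of_conditional_path_law:
  assumes \<kappa>: "conditional_path_law M {0..<w} C (\<lambda>h \<omega>. Z (u + h) \<omega> - Z u \<omega>) \<kappa>"
    and x: "u = 0 \<Longrightarrow> x = 0"
  shows "gmsi_process (\<kappa> (x, z)) (ereal w) \<Theta> (\<Theta> / w) (\<lambda>h f. f h - z / w * h)"
proof -
  let ?N = "\<kappa> (x, z)" and ?T = "{0..<w}"
  define Y where "Y = (\<lambda>h (f :: real \<Rightarrow> real). f h - z / w * h)"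
  have kernel: "\<kappa> \<in> borel \<rightarrow>\<^sub>M prob_algebra (path_space ?T)"
    using \<kappa> by (simp add: conditional_path_law_def regular_conditional_law_def)
  then have "?N \<in> space (prob_algebra (path_space ?T))" by (rule measurable_space) simp
  then have sets: "sets ?N = sets (path_space ?T)" and "prob_space ?N"
    by (auto simp: space_prob_algebra)
  interpret N: prob_space ?N by fact
  have comb: "(\<lambda>f. \<Sum>t\<in>J. a t * f t) \<in> borel_measurable ?N" if "J \<subseteq> ?T" for J a
    using measurable_path_space_combination[OF that, of a] by (simp cong: measurable_cong_sets add: sets)
  have law: "(\<lambda>f. \<Sum>t\<in>J. a t * Y t f) \<in> borel_measurable ?N"
    "(LINT f|?N. cis (s * (\<Sum>t\<in>J. a t * Y t f))) =
        exp (- (s\<^sup>2 * G.cov (\<lambda>\<omega>. \<Sum>t\<in>J. a t * B t \<omega>) (\<lambda>\<omega>. \<Sum>t\<in>J. a t * B t \<omega>)) / 2)"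
    if J: "finite J" "J \<subseteq> ?T" for J a s
  proof -
    let ?m = "(\<Sum>t\<in>J. a t * (t / w)) * z"
    let ?W = "\<lambda>\<omega>. \<Sum>t\<in>J. a t * B t \<omega>"
    have W: "?W \<in> H" using J by (intro G.sum_H G.scale_H B_in_H) auto
    note [measurable] = comb[OF J(2)] G.measurable_H[OF W]
    have "(\<Sum>t\<in>J. a t * (z / w * t)) = ?m"
      unfolding sum_distrib_right by (intro sum.cong) auto
    then have Y: "(\<Sum>t\<in>J. a t * Y t f) = (\<Sum>t\<in>J. a t * f t) - ?m" for f
      by (simp only: Y_def right_diff_distrib sum_subtractf)
    show "(\<lambda>f. \<Sum>t\<in>J. a t * Y t f) \<in> borel_measurable ?N" unfolding Y by measurable
    have "distr ?N borel (\<lambda>f. \<Sum>t\<in>J. a t * f t) = distr (bridge_law (x, z)) borel (\<lambda>f. \<Sum>t\<in>J. a t * f t)"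
      using x by (intro conditional_path_law_unique[OF prob_space_axioms measurable_C \<kappa> bridge_law_conditional _ J]
          C_near_pos) auto
    then have *: "distr ?N borel (\<lambda>f. \<Sum>t\<in>J. a t * f t) = distr M borel (\<lambda>\<omega>. ?W \<omega> + ?m)"
      by (simp add: distr_bridge_law[OF J(2)])
    have "(LINT f|?N. cis (s * (\<Sum>t\<in>J. a t * Y t f))) =
        (LINT y|distr ?N borel (\<lambda>f. \<Sum>t\<in>J. a t * f t). cis (s * (y - ?m)))"
      unfolding Y by (subst integral_distr) measurable
    also have "\<dots> = (LINT \<omega>|M. cis (s * ?W \<omega>))"
      unfolding * by (subst integral_distr) auto
    also have "\<dots> = exp (- (s\<^sup>2 * G.cov ?W ?W) / 2)" by (rule G.cis_scale_cov[OF W])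
    finally show "(LINT f|?N. cis (s * (\<Sum>t\<in>J. a t * Y t f))) = exp (- (s\<^sup>2 * G.cov ?W ?W) / 2)" .
  qed
  have moments: "gaussian_rv ?N (\<lambda>f. \<Sum>t\<in>J. a t * Y t f)"
    "N.expectation (\<lambda>f. \<Sum>t\<in>J. a t * Y t f) = 0"
    "N.expectation (\<lambda>f. (\<Sum>t\<in>J. a t * Y t f)\<^sup>2) =
      G.cov (\<lambda>\<omega>. \<Sum>t\<in>J. a t * B t \<omega>) (\<lambda>\<omega>. \<Sum>t\<in>J. a t * B t \<omega>)"
    if "finite J" "J \<subseteq> ?T" for J a
    by (rule N.gaussian_rv_of_cis[OF law(1)[OF that] G.cov_nonneg law(2)[OF that]])+
  have "gaussian_process ?N ?T Y"
    unfolding gaussian_process_def using moments(1) by blast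
  moreover have "N.expectation (Y t) = 0" if "t \<in> ?T" for t
    using moments(2)[of "{t}" "\<lambda>_. 1"] that by simp
  ultimately interpret S: gaussian_space ?N "process_span ?T Y"
    by (rule N.gaussian_space_process_span)
  have Y_in: "Y t \<in> process_span ?T Y" if "t \<in> ?T" for t using that by (rule process_span_component)
  have B_in: "B t \<in> H" if "t \<in> ?T" for t using that by (intro B_in_H) auto
  have var_sum: "S.cov (\<lambda>f. \<Sum>t\<in>J. a t * Y t f) (\<lambda>f. \<Sum>t\<in>J. a t * Y t f) =
      G.cov (\<lambda>\<omega>. \<Sum>t\<in>J. a t * B t \<omega>) (\<lambda>\<omega>. \<Sum>t\<in>J. a t * B t \<omega>)" if "finite J" "J \<subseteq> ?T" for J a
    using moments(3)[of J a] that by (simp add: S.cov_def power2_eq_square)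
  have var: "S.cov (Y t) (Y t) = G.cov (B t) (B t)" if "t \<in> ?T" for t
    using var_sum[of "{t}" "\<lambda>_. 1"] that by simp
  \<comment> \<open>Polarization: only variances have been transferred so far, and the variance of
    \<open>Y s + Y t\<close> yields the covariance. For \<open>s = t\<close> the set
    \<open>{s, t}\<close> collapses, which is why this case is left to \<open>var\<close>.\<close>
  have cov: "S.cov (Y s) (Y t) = G.cov (B s) (B t)" if "s \<in> ?T" "t \<in> ?T" "s \<noteq> t" for s t
  proof -
    have "S.cov (\<lambda>f. Y s f + Y t f) (\<lambda>f. Y s f + Y t f) = G.cov (\<lambda>\<omega>. B s \<omega> + B t \<omega>) (\<lambda>\<omega>. B s \<omega> + B t \<omega>)"
      using var_sum[of "{s, t}" "\<lambda>_. 1"] that by simp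
    then have "S.cov (Y s) (Y s) + 2 * S.cov (Y s) (Y t) + S.cov (Y t) (Y t) =
        G.cov (B s) (B s) + 2 * G.cov (B s) (B t) + G.cov (B t) (B t)"
      using that by (simp add: S.cov_add_left S.cov_add_right G.cov_add_left G.cov_add_right S.add_H G.add_H
          Y_in B_in S.cov_commute[of "Y t" "Y s"] G.cov_commute[of "B t" "B s"])
    then show ?thesis using var that by simp
  qed
  have "gmsi_process ?N (ereal w) \<Theta> (\<Theta> / w) Y"
  proof (rule S.gmsi_of_bridge_cov[OF Y_in w_pos \<Theta>_pos])
    fix s t assume st: "s \<in> ?T" "t \<in> ?T" "s \<le> t"
    have "S.cov (Y s) (Y t) = G.cov (B s) (B t)" using cov[OF st(1,2)] var[OF st(1)] by (cases "s = t") auto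
    then show "S.cov (Y s) (Y t) = s * (\<Theta> - \<Theta> / w * t)" using st by (simp add: cov_B)
  next
    fix f assume "f \<in> space ?N"
    then have "continuous_on ?T f"
      using sets_eq_imp_space_eq[OF sets] by (simp add: space_path_space)
    then show "continuous_on ?T (\<lambda>t. Y t f)" unfolding Y_def by (intro continuous_intros)
  qed auto
  then show ?thesis by (simp add: Y_def)
qed

end

text \<open>The existence clause keeps the statement about every version from being vacuous. At
  \<open>u = 0\<close> the conditioning value is confined to \<open>x = 0\<close>, since there the
  first component of the conditioning vector is almost surely 0.\<close>

theorem proposition3:
  fixes M :: "'a measure"
    and X :: "'n::finite \<Rightarrow> real \<Rightarrow> 'a \<Rightarrow> real"
    and Z :: "real \<Rightarrow> 'a \<Rightarrow> real"
    and \<theta> \<tau> k :: "'n \<Rightarrow> real"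
    and \<Delta> :: ereal
    and \<rho> u w :: real
  assumes "prob_space M"
    and "\<And>i. 0 < \<theta> i"
    and "\<And>i. \<tau> i \<noteq> 0"
    and "0 < \<Delta>"
    and "\<And>i. 0 < \<tau> i \<Longrightarrow> \<Delta> \<le> ereal (\<theta> i / \<tau> i)"
    and "\<And>i. gmsi_process M \<Delta> (\<theta> i) (\<tau> i) (X i)"
    and "prob_space.indep_vars M (\<lambda>i. \<Pi>\<^sub>M t\<in>time_dom \<Delta>. borel)
           (\<lambda>i \<omega>. \<lambda>t\<in>time_dom \<Delta>. X i t \<omega>) UNIV"
    and "\<exists>i. k i \<noteq> 0"
    and "Z = (\<lambda>t \<omega>. \<rho> * t + (\<Sum>i\<in>UNIV. k i * X i t \<omega>))"
    and "0 \<le> u" and "ereal u < \<Delta>"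
    and "0 < w" and "ereal w < \<Delta> - ereal u"
  shows "(\<exists>\<kappa> :: (real ^ 'n) \<times> real \<Rightarrow> (real \<Rightarrow> real) measure.
            conditional_path_law M {0..<w}
              (\<lambda>\<omega>. ((\<chi> i. X i u \<omega>), Z (u + w) \<omega> - Z u \<omega>))
              (\<lambda>h \<omega>. Z (u + h) \<omega> - Z u \<omega>) \<kappa>) \<and>
         (\<forall>\<kappa> :: (real ^ 'n) \<times> real \<Rightarrow> (real \<Rightarrow> real) measure.
            conditional_path_law M {0..<w}
              (\<lambda>\<omega>. ((\<chi> i. X i u \<omega>), Z (u + w) \<omega> - Z u \<omega>))
              (\<lambda>h \<omega>. Z (u + h) \<omega> - Z u \<omega>) \<kappa> \<longrightarrow>
            (\<forall>x z. (u = 0 \<longrightarrow> x = 0) \<longrightarrow>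
               gmsi_process (\<kappa> (x, z)) (ereal w)
                 (\<Sum>i\<in>UNIV. (k i)\<^sup>2 * \<theta> i) ((\<Sum>i\<in>UNIV. (k i)\<^sup>2 * \<theta> i) / w)
                 (\<lambda>h f. f h - z / w * h)))"
proof -
  interpret S: gmsi_sum M X \<theta> \<tau> k \<Delta> \<rho> u w
    using assms by (simp add: gmsi_sum_def gmsi_sum_axioms_def)
  have Z: "S.Z = Z" using assms(9) by (simp add: fun_eq_iff S.Z_def)
  have C: "S.C = (\<lambda>\<omega>. ((\<chi> i. X i u \<omega>), Z (u + w) \<omega> - Z u \<omega>))"
    by (simp add: fun_eq_iff S.C_def Z)
  show ?thesis
    using S.bridge_law_conditional S.gmsi_of_conditional_path_law unfolding C Z by blast
qed

end
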